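(* Consider recursive Path ORAM for $N$ data blocks with uniform block size: in every level of the recursion each block has size $\chi\log N$ bits, where $\chi\ge 2$. Then the number of levels of recursion is $O\!\left(\frac{\log N}{\log\chi}\right)$, and hence the bandwidth overhead is $O\!\left(\frac{\log^2 N}{\log\chi}\right)$ blocks per load/store operation. Moreover: (i) (Separate local storage for the stashes of different levels.) In order to make the failure probability for each stash $\frac{1}{N^{\omega(1)}}$, the capacity of each stash can be set to $\Theta(\log N)\cdot\omega(1)$ blocks. Hence storing the stashes from all levels needs $O\!\left(\frac{\log^2 N}{\log\chi}\right)\cdot\omega(1)$ blocks of storage. (ii) (Common local storage for the stashes of all levels.) If a common local storage is used to store the stash blocks from all levels of recursion, then the capacity of the common storage can be set to $\Theta(\log N)\cdot\omega(1)$ blocks to achieve failure probability $\frac{1}{N^{\omega(1)}}$.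
   Context: Non-recursive Path ORAM. There is a complete binary tree of height $L$, stored on a server, with levels $0$ (root) to $L$ (leaves) and leaves labelled $0,\dots,2^L-1$. Each node is a bucket holding at most $Z$ real blocks, padded with dummy blocks to exactly $Z$ blocks. $\mathcal P(x)$ is the set of buckets on the path from leaf $x$ to the root, and $\mathcal P(x,\ell)$ is its bucket at level $\ell$. The client keeps a stash $S$ (a set of blocks), and a position map gives each block address $a$ a leaf label. Initially the buckets and stash contain no real blocks and the labels are independent uniform. To access (read or write) block $a$ with current label $x$: (1) replace the label of $a$ by a fresh independent uniform label; (2) read all buckets of $\mathcal P(x)$ from the server, moving their real blocks into $S$ (if $a$ was never accessed before, it is created in $S$ with a default value), and read or update block $a$; (3) for $\ell=L,L-1,\dots,0$, let $S'$ be the set of blocks in $S$ whose current label $x'$ satisfies $\mathcal P(x',\ell)=\mathcal P(x,\ell)$, move $\min(|S'|,Z)$ of them from $S$ into bucket $\mathcal P(x,\ell)$, pad with dummies and write the bucket to the server. Here the bucket size is the constant $Z=5$, and an ORAM for $n$ blocks uses height $L=\lceil\log n\rceil$. Bandwidth is measured as the number of blocks (real or dummy) read from or written to the server. Recursive Path ORAM is a series of non-recursive Path ORAMs $\mathsf{ORam}_0,\mathsf{ORam}_1,\dots,\mathsf{ORam}_X$. $\mathsf{ORam}_0$ contains the $N$ data blocks. To reduce client storage, the position map of $\mathsf{ORam}_i$ is not kept by the client but is stored in the smaller ORAM $\mathsf{ORam}_{i+1}$ (a block of $\chi\log N$ bits holds about $\chi$ leaf labels), and one recurses; the client stores the position map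 of the last ORAM, $\mathsf{ORam}_X$. To access a block in $\mathsf{ORam}_0$, the client looks up its position in $\mathsf{ORam}_1$, which triggers a recursive lookup of the position of that position in $\mathsf{ORam}_2$, and so on, until a position for $\mathsf{ORam}_X$ is looked up in client storage. Different levels use independent randomness. Stash contents are considered at a moment after a sequence of load/store operations has been executed (at the end of an operation, after step (3)); the address sequence is fixed independently of the random labels. In (i), failure of a stash means that at this moment it contains more blocks than its capacity. In (ii), failure means that at this moment the total number of blocks in the stashes of all levels exceeds the capacity of the common storage. Notation: all logarithms are base 2, and $g=O(f)\cdot\omega(1)$ means that for any function $h=\omega(1)$ one has $g=O(f\cdot h)$; similarly for $\Theta(f)\cdot\omega(1)$. Asymptotics are as $N\to\infty$.
   Formalization: The bounds on the number of levels, the bandwidth overhead and the total separate stash storage are stated for log χ = O(log N); they fail for larger χ, since there is always at least one level. The failure-probability claims hold for all χ ≥ 2. *)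

theory Defs
  imports "HOL-Probability.Probability" "HOL-Library.Landau_Symbols"
begin

section \<open>Non-recursive Path ORAM\<close>

definition bucket_size :: nat where
  "bucket_size = 5"

text \<open>
  A block is represented by its address: payloads influence neither the labels, nor the stash,
  nor the number of blocks transferred. A bucket is represented by its set of real blocks; the
  dummies pad it to \<^const>\<open>bucket_size\<close> blocks, so each read or write of a bucket transfers
  exactly \<^const>\<open>bucket_size\<close> blocks. The field \<open>transferred\<close> counts all blocks
  read from or written to the server so far. Buckets are indexed by (level, position in level).
\<close>

record oram =
  tree_height :: nat
  label :: "nat \<Rightarrow> nat"
  bucket :: "nat \<times> nat \<Rightarrow> nat set"
  stash :: "nat set"
  transferred :: nat

definition path_node :: "nat \<Rightarrow> nat \<Rightarrow> nat \<Rightarrow> nat \<times> nat" where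
  "path_node L x l = (l, x div 2 ^ (L - l))"

text \<open>
  The rule that chooses which of the candidate blocks \<open>S'\<close> are written into the bucket at level
  \<open>l\<close> of the path to leaf \<open>x\<close> is left open by the protocol, so it is a parameter; it may depend on
  the whole current state.
\<close>

type_synonym selection = "oram \<Rightarrow> nat \<Rightarrow> nat \<Rightarrow> nat set \<Rightarrow> nat set"

definition valid_selection :: "selection \<Rightarrow> bool" where
  "valid_selection sel \<longleftrightarrow>
     (\<forall>s x l S'. finite S' \<longrightarrow> sel s x l S' \<subseteq> S' \<and> card (sel s x l S') = min (card S') bucket_size)"

definition read_bucket :: "nat \<Rightarrow> nat \<Rightarrow> oram \<Rightarrow> oram" where
  "read_bucket x l s =
     (let v = path_node (tree_height s) x l in
      s\<lparr>stash := stash s \<union> bucket s v,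
        bucket := (bucket s)(v := {}),
        transferred := transferred s + bucket_size\<rparr>)"

definition write_bucket :: "selection \<Rightarrow> nat \<Rightarrow> nat \<Rightarrow> oram \<Rightarrow> oram" where
  "write_bucket sel x l s =
     (let v = path_node (tree_height s) x l;
          S' = {b \<in> stash s. path_node (tree_height s) (label s b) l = v};
          W = sel s x l S' in
      s\<lparr>stash := stash s - W,
        bucket := (bucket s)(v := W),
        transferred := transferred s + bucket_size\<rparr>)"

text \<open>
  If \<open>a\<close> was accessed before, it is in the stash after the path has been read, and the insertion
  has no effect; otherwise the insertion creates it.
\<close>

definition access :: "selection \<Rightarrow> nat \<Rightarrow> oram \<Rightarrow> oram pmf" where
  "access sel a s = do {
     let x = label s a;
     y \<leftarrow> pmf_of_set {..<2 ^ tree_height s};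
     let s1 = s\<lparr>label := (label s)(a := y)\<rparr>;
     let s2 = fold (read_bucket x) [0..<Suc (tree_height s)] s1;
     let s3 = s2\<lparr>stash := insert a (stash s2)\<rparr>;
     return_pmf (fold (write_bucket sel x) (rev [0..<Suc (tree_height s)]) s3)
   }"

definition height_for :: "nat \<Rightarrow> nat" where
  "height_for n = nat \<lceil>log 2 (real n)\<rceil>"

definition init_oram :: "nat \<Rightarrow> oram pmf" where
  "init_oram n =
     map_pmf (\<lambda>f. \<lparr>tree_height = height_for n, label = f, bucket = (\<lambda>_. {}), stash = {},
                   transferred = 0\<rparr>)
       (Pi_pmf {..<n} 0 (\<lambda>_. pmf_of_set {..<2 ^ height_for n}))"


section \<open>Recursive Path ORAM\<close>

definition block_bits :: "real \<Rightarrow> nat \<Rightarrow> real" where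
  "block_bits chi N = chi * log 2 (real N)"

text \<open>
  Every label is budgeted \<open>log N\<close> bits, so that a block holds \<open>\<lfloor>chi\<rfloor>\<close> labels. (With
  \<open>\<lceil>log N\<rceil>\<close> bits per label, \<open>chi = 2\<close> would give one label per block unless \<open>N\<close> is a power of
  two, and the recursion would never shrink.)
\<close>

definition labels_per_block :: "real \<Rightarrow> nat \<Rightarrow> nat" where
  "labels_per_block chi N = nat \<lfloor>block_bits chi N / log 2 (real N)\<rfloor>"

lemma labels_per_block_eq:
  assumes "N \<ge> 2"
  shows "labels_per_block chi N = nat \<lfloor>chi\<rfloor>"
proof -
  have "log 2 (real N) > 0"
    using assms by (intro zero_less_log_cancel_iff[THEN iffD2]) auto
  then show ?thesis
    by (simp add: labels_per_block_def block_bits_def)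
qed

text \<open>Number of blocks of the \<open>i\<close>-th ORAM, when a block holds \<open>k\<close> labels.\<close>

primrec level_blocks :: "nat \<Rightarrow> nat \<Rightarrow> nat \<Rightarrow> nat" where
  "level_blocks k N 0 = N"
| "level_blocks k N (Suc i) = nat \<lceil>real (level_blocks k N i) / real k\<rceil>"

text \<open>
  The recursion stops at the first ORAM whose position map has at most \<open>m\<close> labels; that map is
  stored by the client.
\<close>

definition last_level :: "real \<Rightarrow> nat \<Rightarrow> nat \<Rightarrow> nat" where
  "last_level chi m N = (LEAST i. level_blocks (labels_per_block chi N) N i \<le> m)"

definition num_levels :: "real \<Rightarrow> nat \<Rightarrow> nat \<Rightarrow> nat" where
  "num_levels chi m N = Suc (last_level chi m N)"

primrec init_orams :: "nat list \<Rightarrow> oram list pmf" where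
  "init_orams [] = return_pmf []"
| "init_orams (n # ns) = do {
     s \<leftarrow> init_oram n;
     ss \<leftarrow> init_orams ns;
     return_pmf (s # ss)
   }"

definition init_rec :: "real \<Rightarrow> nat \<Rightarrow> nat \<Rightarrow> oram list pmf" where
  "init_rec chi m N =
     init_orams (map (level_blocks (labels_per_block chi N) N) [0..<num_levels chi m N])"

text \<open>
  The label of address \<open>a\<close> of one ORAM is entry \<open>a mod k\<close> of block \<open>a div k\<close> of the next ORAM in
  the list, so it is looked up and replaced by an access to that block, which comes first. Thus
  the \<open>label\<close> field of an ORAM is the payload of the blocks of the next one.
\<close>

primrec access_rec ::
  "nat \<Rightarrow> (nat \<Rightarrow> selection) \<Rightarrow> nat \<Rightarrow> nat \<Rightarrow> oram list \<Rightarrow> oram list pmf" where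
  "access_rec k sel i a [] = return_pmf []"
| "access_rec k sel i a (s # ss) = do {
     ss' \<leftarrow> access_rec k sel (Suc i) (a div k) ss;
     s' \<leftarrow> access (sel i) a s;
     return_pmf (s' # ss')
   }"

text \<open>One load or store operation on data block \<open>a\<close>; \<open>sel i\<close> is the selection rule of ORAM \<open>i\<close>.\<close>

definition operation ::
  "real \<Rightarrow> nat \<Rightarrow> (nat \<Rightarrow> selection) \<Rightarrow> nat \<Rightarrow> oram list \<Rightarrow> oram list pmf" where
  "operation chi N sel a ss = access_rec (labels_per_block chi N) sel 0 a ss"

primrec operations ::
  "real \<Rightarrow> nat \<Rightarrow> (nat \<Rightarrow> selection) \<Rightarrow> nat list \<Rightarrow> oram list \<Rightarrow> oram list pmf" where
  "operations chi N sel [] ss = return_pmf ss"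
| "operations chi N sel (a # as) ss = do {
     ss' \<leftarrow> operation chi N sel a ss;
     operations chi N sel as ss'
   }"

definition rec_path_oram ::
  "real \<Rightarrow> nat \<Rightarrow> nat \<Rightarrow> (nat \<Rightarrow> selection) \<Rightarrow> nat list \<Rightarrow> oram list pmf" where
  "rec_path_oram chi m N sel as = do {
     ss \<leftarrow> init_rec chi m N;
     operations chi N sel as ss
   }"

definition total_transferred :: "oram list \<Rightarrow> nat" where
  "total_transferred ss = (\<Sum>s\<leftarrow>ss. transferred s)"

text \<open>
  \<open>B\<close> bounds the number of blocks transferred by any single operation, in every execution.
\<close>

definition bandwidth_bound :: "real \<Rightarrow> nat \<Rightarrow> nat \<Rightarrow> real \<Rightarrow> bool" where
  "bandwidth_bound chi m N B \<longleftrightarrow>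
     (\<forall>sel as a ss ss'.
        (\<forall>i. valid_selection (sel i)) \<longrightarrow> set as \<subseteq> {..<N} \<longrightarrow> a < N \<longrightarrow>
        ss \<in> set_pmf (rec_path_oram chi m N sel as) \<longrightarrow> ss' \<in> set_pmf (operation chi N sel a ss) \<longrightarrow>
        real (total_transferred ss') - real (total_transferred ss) \<le> B)"

definition stash_failure ::
  "real \<Rightarrow> nat \<Rightarrow> nat \<Rightarrow> (nat \<Rightarrow> selection) \<Rightarrow> nat list \<Rightarrow> nat \<Rightarrow> nat \<Rightarrow> real" where
  "stash_failure chi m N sel as i R =
     measure_pmf.prob (rec_path_oram chi m N sel as) {ss. card (stash (ss ! i)) > R}"

definition common_failure ::
  "real \<Rightarrow> nat \<Rightarrow> nat \<Rightarrow> (nat \<Rightarrow> selection) \<Rightarrow> nat list \<Rightarrow> nat \<Rightarrow> real" where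
  "common_failure chi m N sel as R =
     measure_pmf.prob (rec_path_oram chi m N sel as) {ss. (\<Sum>s\<leftarrow>ss. card (stash s)) > R}"


section \<open>Asymptotics\<close>

text \<open>
  \<open>\<omega>(1)\<close> is read as a function tending to \<open>+\<infinity>\<close>. (The Landau class \<open>\<omega>(\<lambda>_. 1)\<close> of the library only
  looks at absolute values, which is too weak for an exponent.)
\<close>

definition superconstant :: "(nat \<Rightarrow> real) \<Rightarrow> bool" where
  "superconstant h \<longleftrightarrow> filterlim h at_top at_top"

text \<open>All numbers in \<open>P N\<close> are at most \<open>1 / N\<close> to the power \<open>\<omega>(1)\<close>, with the same exponent.\<close>

definition superpoly_small :: "(nat \<Rightarrow> real set) \<Rightarrow> bool" where
  "superpoly_small P \<longleftrightarrow>
     (\<exists>e. superconstant e \<and> (\<forall>\<^sub>F N in at_top. \<forall>p \<in> P N. p \<le> 1 / real N powr e N))"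

text \<open>
  There is always at least one level, and an access to it transfers \<open>\<Theta>(log N)\<close> blocks, so bounds
  of the form \<open>O(log N / log chi)\<close> on the number of levels presuppose \<open>log chi = O(log N)\<close>.
  Every constant \<open>chi\<close> and every \<open>chi\<close> polynomial in \<open>N\<close> qualifies.
\<close>

definition polynomially_bounded :: "(nat \<Rightarrow> real) \<Rightarrow> bool" where
  "polynomially_bounded chi \<longleftrightarrow> (\<lambda>N. log 2 (chi N)) \<in> O(\<lambda>N. log 2 (real N))"

end

theory Submission
  imports Defs
begin

text \<open>
  Call a block cold for a node of the tree if no path accessed since the last access to the block
  runs through the node. If a block whose label lies below a node \<open>u\<close> is stored strictly above \<open>u\<close>
  and is not cold for \<open>u\<close>, then the bucket at \<open>u\<close> is full: the block was a candidate for it. So, if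
  \<open>K u\<close> is the number of blocks stored strictly above \<open>u\<close> with label below \<open>u\<close>, \<open>X u\<close> the number of
  blocks with label below \<open>u\<close> that are cold for \<open>u\<close>, and \<open>u'\<close>, \<open>u''\<close> are the children of \<open>u\<close>, then \<open>K u \<le> X u\<close> or
  \<open>K u + 5 \<le> K u' + K u''\<close>, and for \<open>c = 5/3\<close> we get
  \<open>c ^ K u \<le> c ^ X u + c ^ - 5 * c ^ K u' * c ^ K u''\<close>, where \<open>K root\<close> is the size of the stash.
  The current labels and the paths accessed so far are independent and uniform, and this makes the
  expectation of a product of \<open>c ^ X u\<close> over \<open>d\<close> disjoint regions at most \<open>3 ^ d\<close>. As
  \<open>3 + c ^ - 5 * 6 * 6 \<le> 6\<close>, expanding the recursion gives expectation at most 6 for \<open>c ^ K root\<close>.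

  Different levels of the recursion are independent, so the total size \<open>S\<close> of the stashes of \<open>m\<close>
  levels satisfies \<open>E (c ^ S) \<le> 6 ^ m\<close>. Since \<open>m = O(log N)\<close>, Markov's inequality bounds the
  probability of \<open>S > R\<close> by \<open>N ^ O(1) * c ^ - R\<close>, and a single stash is no larger than the total.
\<close>


subsection \<open>Full buckets below waiting blocks\<close>

text \<open>In a tree of height \<open>L\<close>, these are the labels whose path runs through node
  \<open>(l, p)\<close>.\<close>

definition region :: "nat \<Rightarrow> nat \<Rightarrow> nat \<Rightarrow> nat set" where
  "region L l p = {x. x div 2 ^ (L - l) = p}"

text \<open>An entry of the history is an address with the leaf whose path was read, latest entry
  first. The path read by the last access to \<open>b\<close> itself counts, because
  \<open>b\<close> can be written back along it at once. A block that was never accessed is not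
  cold.\<close>

primrec cold :: "nat set \<Rightarrow> nat \<Rightarrow> (nat \<times> nat) list \<Rightarrow> bool" where
  "cold r b [] \<longleftrightarrow> False"
| "cold r b (ax # H) \<longleftrightarrow> snd ax \<notin> r \<and> (fst ax = b \<or> cold r b H)"

text \<open>All buckets on the levels before \<open>l\<close> are taken, not only the ancestors of
  one node: every stored block lies on the path to its label, so a condition on the label singles
  out the ancestors.\<close>

definition above :: "oram \<Rightarrow> nat \<Rightarrow> nat set" where
  "above s l = stash s \<union> (\<Union>l'<l. \<Union>p. bucket s (l', p))"

definition stored_ok :: "oram \<Rightarrow> nat set \<Rightarrow> bool" where
  "stored_ok s B \<longleftrightarrow>
     (\<forall>l p b. b \<in> bucket s (l, p) \<longrightarrow> l \<le> tree_height s \<and> label s b \<in> region (tree_height s) l p) \<and>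
     (\<forall>v b. b \<in> bucket s v \<longrightarrow> b \<notin> stash s) \<and>
     (\<forall>v w b. b \<in> bucket s v \<longrightarrow> b \<in> bucket s w \<longrightarrow> v = w) \<and>
     finite B \<and> stash s \<subseteq> B \<and> (\<forall>v. bucket s v \<subseteq> B)"

lemma stored_okD:
  assumes "stored_ok s B"
  shows "b \<in> bucket s (l, p) \<Longrightarrow> l \<le> tree_height s"
    and "b \<in> bucket s (l, p) \<Longrightarrow> label s b \<in> region (tree_height s) l p"
    and "b \<in> bucket s v \<Longrightarrow> b \<notin> stash s"
    and "b \<in> bucket s v \<Longrightarrow> b \<in> bucket s w \<Longrightarrow> v = w"
    and "finite B" "stash s \<subseteq> B" "bucket s v \<subseteq> B"
  using assms unfolding stored_ok_def by blast+

text \<open>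
  The invariant while the path to leaf \<open>x\<close> is written back, at the moment when its levels from
  \<open>j\<close> on are done. A block that is not cold for a node could have been moved into its bucket
  since the last access to the block.
\<close>

definition writing_ok :: "nat \<Rightarrow> nat \<Rightarrow> oram \<Rightarrow> (nat \<times> nat) list \<Rightarrow> bool" where
  "writing_ok j x s H \<longleftrightarrow>
     stored_ok s (fst ` set H) \<and>
     (\<forall>l<j. bucket s (path_node (tree_height s) x l) = {}) \<and>
     (\<forall>l\<le>tree_height s. \<forall>p. \<forall>b\<in>above s l.
        label s b \<in> region (tree_height s) l p \<longrightarrow> \<not> cold (region (tree_height s) l p) b H \<longrightarrow>
        j \<le> l \<or> path_node (tree_height s) x l \<noteq> (l, p) \<longrightarrow> card (bucket s (l, p)) = bucket_size)"

text \<open>Once all levels are written back, the clauses about the path hold vacuously for every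
  leaf; \<open>0\<close> stands for any of them.\<close>

definition oram_ok :: "oram \<Rightarrow> (nat \<times> nat) list \<Rightarrow> bool" where
  "oram_ok s H \<longleftrightarrow> writing_ok 0 0 s H"

lemma writing_ok_0: "writing_ok 0 x s H = oram_ok s H"
  by (simp add: oram_ok_def writing_ok_def)

lemma div_pow_mono_eq:
  assumes "(x::nat) div 2 ^ (L - l') = y div 2 ^ (L - l')" "l \<le> l'" "l' \<le> L"
  shows "x div 2 ^ (L - l) = y div 2 ^ (L - l)"
proof -
  have "x div 2 ^ (L - l) = x div 2 ^ (L - l') div 2 ^ (l' - l)" for x :: nat
    using assms(2,3) by (simp add: div_mult2_eq[symmetric] power_add[symmetric])
  then show ?thesis
    using assms(1) by simp
qed

section \<open>Writing back one path\<close>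

lemma write_bucket_simps [simp]:
  "label (write_bucket sel x l s) = label s"
  "tree_height (write_bucket sel x l s) = tree_height s"
  "transferred (write_bucket sel x l s) = transferred s + bucket_size"
  by (simp_all add: write_bucket_def Let_def)

lemma fold_write_bucket_simps [simp]:
  "label (fold (write_bucket sel x) ls s) = label s"
  "tree_height (fold (write_bucket sel x) ls s) = tree_height s"
  "transferred (fold (write_bucket sel x) ls s) = transferred s + length ls * bucket_size"
  by (induction ls arbitrary: s) simp_all

text \<open>Only the bucket at the path node \<open>v\<close> of level \<open>j\<close> changes, so
  other nodes inherit their full buckets. A block still waiting for \<open>v\<close> was a candidate
  that the selection passed over, and candidates are passed over only when the bucket is
  full.\<close>

lemma writing_ok_write_bucket:
  assumes sel: "valid_selection sel" and ok: "writing_ok (Suc j) x s H" and j: "j \<le> tree_height s"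
  shows "writing_ok j x (write_bucket sel x j s) H"
proof -
  define L where "L = tree_height s"
  define v where "v = path_node L x j"
  define S' where "S' = {b \<in> stash s. path_node L (label s b) j = v}"
  define W where "W = sel s x j S'"
  define s' where "s' = write_bucket sel x j s"
  have st: "stash s' = stash s - W" and bu: "bucket s' = (bucket s)(v := W)"
    by (simp_all add: s'_def write_bucket_def Let_def W_def S'_def v_def L_def)
  have la: "label s' = label s" and th: "tree_height s' = L"
    by (simp_all add: s'_def L_def)
  have sok: "stored_ok s (fst ` set H)"
    using ok by (simp add: writing_ok_def)
  have loc: "l \<le> L" "label s b \<in> region L l p" if "b \<in> bucket s (l, p)" for l p b
    using sok that by (auto simp: stored_ok_def L_def)
  have empty: "bucket s (path_node L x l) = {}" if "l \<le> j" for l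
    using ok that by (simp add: writing_ok_def L_def)
  have fin: "finite (stash s)"
    using sok unfolding stored_ok_def by (meson finite_subset)
  then have "finite S'" by (simp add: S'_def)
  then have W: "W \<subseteq> S'" "card W = min (card S') bucket_size"
    using sel by (simp_all add: valid_selection_def W_def)
  have v: "v = (j, x div 2 ^ (L - j))"
    by (simp add: v_def path_node_def)
  have Wst: "W \<subseteq> stash s"
    using W(1) by (auto simp: S'_def)
  have "stored_ok s' (fst ` set H)"
    using sok W(1) Wst j
    by (auto simp: stored_ok_def st bu la th v S'_def path_node_def region_def L_def split: if_splits)
  moreover have "bucket s' (path_node L x l) = {}" if "l < j" for l
    using empty[of l] that by (simp add: bu v path_node_def)
  moreover have "card (bucket s' (l, p)) = bucket_size"
    if l: "l \<le> L" and b: "b \<in> above s' l" "label s b \<in> region L l p"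
      "\<not> cold (region L l p) b H" and jl: "j \<le> l \<or> path_node L x l \<noteq> (l, p)" for l p b
  proof (cases "(l, p) = v")
    case False
    have "b \<in> above s l"
      using b(1) Wst by (auto simp: above_def st bu split: if_splits)
    moreover have "Suc j \<le> l \<or> path_node L x l \<noteq> (l, p)"
      using jl False v by (cases "l = j") (auto simp: path_node_def)
    ultimately have "card (bucket s (l, p)) = bucket_size"
      using ok l b(2,3) by (auto simp: writing_ok_def L_def)
    then show ?thesis
      using False by (simp add: bu)
  next
    case True
    \<comment> \<open>A bucket before level \<open>j\<close> holding \<open>b\<close> would lie on
      the path to the label of \<open>b\<close>. Down to \<open>v\<close> this is the path to
      \<open>x\<close>, whose buckets on these levels are still empty.\<close>
    have "b \<in> stash s - W"
    proof (rule ccontr)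
      assume "b \<notin> stash s - W"
      then obtain l' p' where l': "l' < l" "b \<in> bucket s (l', p')"
        using b(1) True v by (auto simp: above_def st bu split: if_splits)
      have "label s b div 2 ^ (L - l) = x div 2 ^ (L - l)"
        using b(2) True v by (simp add: region_def)
      then have "label s b div 2 ^ (L - l') = x div 2 ^ (L - l')"
        using div_pow_mono_eq[of "label s b" L l x l'] l' l by simp
      then have "(l', p') = path_node L x l'"
        using loc[OF l'(2)] by (simp add: region_def path_node_def)
      then show False
        using empty[of l'] l' True v by auto
    qed
    then have "b \<in> S' - W"
      using b(2) True v by (auto simp: S'_def path_node_def region_def)
    then have "card W < card S'"
      using W(1) \<open>finite S'\<close> by (intro psubset_card_mono) auto
    then show ?thesis
      using W(2) True by (simp add: bu)
  qed
  ultimately show ?thesis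
    unfolding writing_ok_def s'_def[symmetric] th la by auto
qed

lemma writing_ok_fold_write_bucket:
  assumes "valid_selection sel" "writing_ok j x s H" "j \<le> Suc (tree_height s)"
  shows "oram_ok (fold (write_bucket sel x) (rev [0..<j]) s) H"
  using assms(2,3)
proof (induction j arbitrary: s)
  case 0
  then show ?case by (simp add: writing_ok_0)
next
  case (Suc j)
  have "writing_ok j x (write_bucket sel x j s) H"
    using Suc.prems by (intro writing_ok_write_bucket assms(1)) auto
  then show ?case
    using Suc.IH[of "write_bucket sel x j s"] Suc.prems by simp
qed

text \<open>Path nodes of different levels are different, so no read affects another and the loop
  has a closed form.\<close>

lemma fold_read_bucket:
  "fold (read_bucket x) [0..<k] s =
     s\<lparr>stash := stash s \<union> (\<Union>l<k. bucket s (path_node (tree_height s) x l)),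
       bucket := (\<lambda>v. if \<exists>l<k. v = path_node (tree_height s) x l then {} else bucket s v),
       transferred := transferred s + k * bucket_size\<rparr>"
proof (induction k)
  case 0
  then show ?case by simp
next
  case (Suc k)
  have "path_node (tree_height s) x k \<noteq> path_node (tree_height s) x l" if "l < k" for l
    using that by (simp add: path_node_def)
  then have *: "\<not> (\<exists>l<k. path_node (tree_height s) x k = path_node (tree_height s) x l)"
    by blast
  have "fold (read_bucket x) [0..<Suc k] s = read_bucket x k (fold (read_bucket x) [0..<k] s)"
    by simp
  then show ?case
    unfolding Suc read_bucket_def Let_def using *
    by (intro oram.equality) (auto simp: less_Suc_eq fun_eq_iff lessThan_Suc)
qed

text \<open>The only random choice of an access, the new label \<open>y\<close>, is made an
  argument; the rest is deterministic.\<close>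

definition access_step :: "selection \<Rightarrow> nat \<Rightarrow> oram \<Rightarrow> nat \<Rightarrow> oram" where
  "access_step sel a s y =
     (let x = label s a;
          s2 = fold (read_bucket x) [0..<Suc (tree_height s)] (s\<lparr>label := (label s)(a := y)\<rparr>) in
      fold (write_bucket sel x) (rev [0..<Suc (tree_height s)]) (s2\<lparr>stash := insert a (stash s2)\<rparr>))"

lemma access_eq:
  "access sel a s = map_pmf (access_step sel a s) (pmf_of_set {..<2 ^ tree_height s})"
  by (simp add: access_def access_step_def Let_def map_pmf_def)

lemma access_step_simps [simp]:
  "label (access_step sel a s y) = (label s)(a := y)"
  "tree_height (access_step sel a s y) = tree_height s"
  "transferred (access_step sel a s y) = transferred s + 2 * bucket_size * Suc (tree_height s)"
  unfolding access_step_def Let_def fold_read_bucket by (simp_all del: upt_Suc)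

text \<open>After the read, the path to \<open>x\<close> is empty and its nodes are exempt until
  they are written back. At any other node the bucket is as before, and a waiting block that is not
  cold was already waiting and not cold before the access.\<close>

lemma oram_ok_access_step:
  assumes sel: "valid_selection sel" and ok: "oram_ok s H"
  shows "oram_ok (access_step sel a s y) ((a, label s a) # H)"
proof -
  define L where "L = tree_height s"
  define x where "x = label s a"
  define s3 where "s3 = s\<lparr>label := (label s)(a := y),
     bucket := (\<lambda>v. if \<exists>l<Suc L. v = path_node L x l then {} else bucket s v),
     transferred := transferred s + Suc L * bucket_size,
     stash := insert a (stash s \<union> (\<Union>l<Suc L. bucket s (path_node L x l)))\<rparr>"
  have step: "access_step sel a s y = fold (write_bucket sel x) (rev [0..<Suc L]) s3"
    unfolding access_step_def Let_def fold_read_bucket by (simp add: s3_def x_def L_def del: upt_Suc cong: if_cong)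
  have sok: "stored_ok s (fst ` set H)"
    using ok by (simp add: oram_ok_def writing_ok_def)
  have loc: "l \<le> L" "label s b div 2 ^ (L - l) = p" if "b \<in> bucket s (l, p)" for l p b
    using sok that by (auto simp: stored_ok_def L_def region_def)
  \<comment> \<open>The stored copy of \<open>a\<close> lies on the path to its old label, so the
    read removes it from the tree and its new label cannot contradict its position.\<close>
  have on_path: "\<exists>l<Suc L. v = path_node L x l" if "a \<in> bucket s v" for v
    using loc[of a "fst v" "snd v"] that 
    by (intro exI[of _ "fst v"]) (auto simp: path_node_def x_def)
  have "writing_ok (Suc L) x s3 ((a, x) # H)"
  proof -
    have bu: "b \<in> bucket s v" "b \<noteq> a" "b \<notin> stash s3" if b: "b \<in> bucket s3 v" for b v
    proof -
      have off: "v \<noteq> path_node L x l" if "l < Suc L" for l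
        using b that by (auto simp: s3_def split: if_splits)
      show bv: "b \<in> bucket s v"
        using b by (simp add: s3_def split: if_splits)
      show ne: "b \<noteq> a"
        using on_path[of v] off bv by auto
      have "b \<notin> bucket s (path_node L x l)" if "l < Suc L" for l
        using stored_okD(4)[OF sok bv, of "path_node L x l"] off[OF that] by blast
      then show "b \<notin> stash s3"
        using stored_okD(3)[OF sok bv] ne by (auto simp: s3_def)
    qed
    have "stored_ok s3 (fst ` set ((a, x) # H))"
      unfolding stored_ok_def
    proof (intro conjI allI impI)
      show "l \<le> tree_height s3" "label s3 b \<in> region (tree_height s3) l p"
        if "b \<in> bucket s3 (l, p)" for l p b
        using loc[OF bu(1)[OF that]] bu(2)[OF that] by (simp_all add: s3_def L_def region_def)
      show "v = w" if "b \<in> bucket s3 v" "b \<in> bucket s3 w" for b v w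
        using stored_okD(4)[OF sok bu(1)[OF that(1)] bu(1)[OF that(2)]] .
      show "stash s3 \<subseteq> fst ` set ((a, x) # H)"
        using stored_okD(6)[OF sok] stored_okD(7)[OF sok, of "path_node L x l" for l]
        by (fastforce simp: s3_def)
      show "bucket s3 v \<subseteq> fst ` set ((a, x) # H)" for v
        using stored_okD(7)[OF sok, of v] bu(1)[of _ v] by auto
    qed (use bu in auto)
    moreover have "bucket s3 (path_node L x l) = {}" if "l < Suc L" for l
      using that by (auto simp: s3_def)
    moreover have "card (bucket s3 (l, p)) = bucket_size"
      if l: "l \<le> L" and b: "b \<in> above s3 l" "label s3 b \<in> region L l p"
        "\<not> cold (region L l p) b ((a, x) # H)" and off: "Suc L \<le> l \<or> path_node L x l \<noteq> (l, p)" for l p b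
    proof -
      have x: "x div 2 ^ (L - l) \<noteq> p"
        using off l by (auto simp: path_node_def)
      \<comment> \<open>As \<open>x\<close> avoids the region, the longer history would make
        \<open>a\<close> cold and keeps every cold block cold.\<close>
      with b(3) have b': "b \<noteq> a" "\<not> cold (region L l p) b H"
        by (auto simp: region_def)
      have lb: "label s b div 2 ^ (L - l) = p"
        using b(2) b'(1) by (simp add: s3_def region_def)
      have "b \<in> above s l"
      \<comment> \<open>A block that came from the path was stored strictly above level
        \<open>l\<close>; otherwise its label and \<open>x\<close> would share the ancestor
        \<open>(l, p)\<close>.\<close>
      proof (cases "\<exists>l'<Suc L. b \<in> bucket s (path_node L x l')")
        case True
        then obtain l' where l': "l' < Suc L" "b \<in> bucket s (path_node L x l')" by blast
        then have "label s b div 2 ^ (L - l') = x div 2 ^ (L - l')"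
          using loc by (simp add: path_node_def)
        then have "\<not> l \<le> l'"
          using div_pow_mono_eq[of "label s b" L l' x l] x lb l' by auto
        then show ?thesis
          using l' by (auto simp: above_def path_node_def)
      next
        case False
        then show ?thesis
          using b(1) b'(1) by (auto simp: above_def s3_def split: if_splits)
      qed
      then have "card (bucket s (l, p)) = bucket_size"
        using ok b'(2) lb l unfolding oram_ok_def writing_ok_def L_def by (auto simp: region_def)
      moreover have "bucket s3 (l, p) = bucket s (l, p)"
        using x by (auto simp: s3_def path_node_def)
      ultimately show ?thesis by simp
    qed
    ultimately show ?thesis
      unfolding writing_ok_def by (simp add: s3_def L_def)
  qed
  then have "oram_ok (fold (write_bucket sel x) (rev [0..<Suc L]) s3) ((a, x) # H)"
    by (intro writing_ok_fold_write_bucket sel) (simp_all add: s3_def L_def)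
  then show ?thesis
    using step by (simp add: x_def)
qed

section \<open>Branching inequality for the numbers of waiting blocks\<close>

definition waiting :: "oram \<Rightarrow> nat \<Rightarrow> nat \<Rightarrow> nat set" where
  "waiting s l p = {b \<in> above s l. label s b \<in> region (tree_height s) l p}"

text \<open>For the node \<open>u = (l, p)\<close> and its region \<open>r\<close>, the
  cardinalities of \<open>waiting s l p\<close> and \<open>cold_blocks s H r\<close> are the numbers
  \<open>K u\<close> and \<open>X u\<close> of the introduction.\<close>

definition cold_blocks :: "oram \<Rightarrow> (nat \<times> nat) list \<Rightarrow> nat set \<Rightarrow> nat set" where
  "cold_blocks s H r = {b \<in> fst ` set H. label s b \<in> r \<and> cold r b H}"

text \<open>Either all waiting blocks are cold, or one of them is not and the invariant makes the
  bucket full. Its blocks are disjoint from the waiting ones, which adds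
  \<open>bucket_size\<close>.\<close>

lemma waiting_full:
  assumes ok: "oram_ok s H" and l: "l \<le> tree_height s"
  shows "card (waiting s l p) \<le> card (cold_blocks s H (region (tree_height s) l p)) \<or>
         card (waiting s l p) + bucket_size \<le> card (waiting s l p \<union> bucket s (l, p))"
proof -
  have sok: "stored_ok s (fst ` set H)"
    using ok by (simp add: oram_ok_def writing_ok_def)
  have B: "above s l \<subseteq> fst ` set H" "bucket s (l, p) \<subseteq> fst ` set H"
    using sok by (auto simp: stored_ok_def above_def dest!: subsetD)
  show ?thesis
  proof (cases "\<forall>b\<in>waiting s l p. cold (region (tree_height s) l p) b H")
    case True
    then have "waiting s l p \<subseteq> cold_blocks s H (region (tree_height s) l p)"
      using B(1) by (auto simp: waiting_def cold_blocks_def)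
    then show ?thesis
      by (intro disjI1 card_mono) (auto simp: cold_blocks_def)
  next
    case False
    then have "card (bucket s (l, p)) = bucket_size"
      using ok l unfolding oram_ok_def writing_ok_def waiting_def by blast
    moreover have "waiting s l p \<inter> bucket s (l, p) = {}"
      using sok unfolding stored_ok_def waiting_def above_def by fastforce
    moreover have "finite (waiting s l p)" "finite (bucket s (l, p))"
      using B by (auto simp: waiting_def intro: finite_subset[of _ "fst ` set H"])
    ultimately show ?thesis
      by (simp add: card_Un_disjoint)
  qed
qed

lemma region_split:
  assumes "l < L"
  shows "region L l p = region L (Suc l) (2 * p) \<union> region L (Suc l) (2 * p + 1)"
proof -
  have "x div 2 ^ (L - l) = x div 2 ^ (L - Suc l) div 2" for x :: nat
    using assms by (simp add: div_mult2_eq[symmetric] Suc_diff_Suc[symmetric] mult.commute)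
  then show ?thesis
    unfolding region_def by (intro set_eqI) (simp, linarith)
qed

text \<open>Blocks waiting for a node or lying in its bucket are strictly above both children, and
  each label lies below one of them.\<close>

lemma waiting_split:
  assumes ok: "oram_ok s H" and l: "l < tree_height s"
  shows "card (waiting s l p) \<le> card (cold_blocks s H (region (tree_height s) l p)) \<or>
         card (waiting s l p) + bucket_size \<le>
           card (waiting s (Suc l) (2 * p)) + card (waiting s (Suc l) (2 * p + 1))"
proof -
  have sok: "stored_ok s (fst ` set H)"
    using ok by (simp add: oram_ok_def writing_ok_def)
  have fin: "finite (waiting s l p)" for l p
    using sok by (intro finite_subset[of "waiting s l p" "fst ` set H"])
      (auto simp: waiting_def above_def stored_ok_def dest!: subsetD)
  have "waiting s l p \<union> bucket s (l, p) \<subseteq> waiting s (Suc l) (2 * p) \<union> waiting s (Suc l) (2 * p + 1)"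
    using sok region_split[OF l, of p] unfolding stored_ok_def waiting_def above_def
    by (auto simp: less_Suc_eq)
  then have "card (waiting s l p \<union> bucket s (l, p)) \<le>
      card (waiting s (Suc l) (2 * p) \<union> waiting s (Suc l) (2 * p + 1))"
    by (intro card_mono) (auto simp: fin)
  also have "\<dots> \<le> card (waiting s (Suc l) (2 * p)) + card (waiting s (Suc l) (2 * p + 1))"
    by (rule card_Un_le)
  finally show ?thesis
    using waiting_full[OF ok, of l p] l by auto
qed

text \<open>A leaf has no children; the number of all accessed blocks with this label takes over the
  role of \<open>K u' + K u''\<close>.\<close>

lemma waiting_leaf:
  assumes ok: "oram_ok s H"
  shows "card (waiting s (tree_height s) p) \<le> card (cold_blocks s H {p}) \<or>
         card (waiting s (tree_height s) p) + bucket_size \<le> card {b \<in> fst ` set H. label s b = p}"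
proof -
  have sok: "stored_ok s (fst ` set H)"
    using ok by (simp add: oram_ok_def writing_ok_def)
  have "above s (tree_height s) \<subseteq> fst ` set H" "bucket s (tree_height s, p) \<subseteq> fst ` set H"
    using sok by (auto simp: stored_ok_def above_def dest!: subsetD)
  moreover have "bucket s (tree_height s, p) \<subseteq> {b. label s b = p}"
    using stored_okD(2)[OF sok, of _ "tree_height s" p] by (auto simp: region_def)
  ultimately have "waiting s (tree_height s) p \<union> bucket s (tree_height s, p) \<subseteq>
      {b \<in> fst ` set H. label s b = p}"
    by (auto simp: waiting_def region_def)
  then have "card (waiting s (tree_height s) p \<union> bucket s (tree_height s, p)) \<le>
      card {b \<in> fst ` set H. label s b = p}"
    by (intro card_mono) auto
  then show ?thesis
    using waiting_full[OF ok, of "tree_height s" p] by (auto simp: region_def)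
qed


subsection \<open>Independence of current labels and past paths\<close>

text \<open>The ideal law of the recorded history, with an independent uniform leaf for each
  access.\<close>

primrec history :: "nat \<Rightarrow> nat list \<Rightarrow> (nat \<times> nat) list pmf" where
  "history h [] = return_pmf []"
| "history h (a # as) =
     do {x \<leftarrow> pmf_of_set {..<2 ^ h}; H \<leftarrow> history h as; return_pmf ((a, x) # H)}"

text \<open>The list of accesses is in reverse chronological order, as is the recorded history.\<close>

primrec traced_run :: "selection \<Rightarrow> nat \<Rightarrow> nat list \<Rightarrow> (oram \<times> (nat \<times> nat) list) pmf" where
  "traced_run sel n [] = map_pmf (\<lambda>s. (s, [])) (init_oram n)"
| "traced_run sel n (a # as) =
     do {t \<leftarrow> traced_run sel n as;
         map_pmf (\<lambda>s. (s, (a, label (fst t) a) # snd t)) (access sel a (fst t))}"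

lemma set_pmf_of_set_lessThan_power [simp]:
  "set_pmf (pmf_of_set {..<(2::nat) ^ h}) = {..<2 ^ h}"
  by (intro set_pmf_of_set) (auto simp: lessThan_empty_iff)

lemma set_traced_run:
  assumes "valid_selection sel" "(s, H) \<in> set_pmf (traced_run sel n as)"
  shows "oram_ok s H \<and> tree_height s = height_for n \<and> map fst H = as \<and>
    (\<forall>b. label s b < 2 ^ height_for n)"
  using assms(2)
proof (induction as arbitrary: s H)
  case Nil
  then obtain f where f: "f \<in> PiE_dflt {..<n} 0 (\<lambda>_. {..<2 ^ height_for n})"
    and s: "s = \<lparr>tree_height = height_for n, label = f, bucket = (\<lambda>_. {}), stash = {}, transferred = 0\<rparr>"
    and "H = []"
    by (auto simp: init_oram_def set_Pi_pmf)
  \<comment> \<open>Outside \<open>{..<n}\<close> the label is the default value 0, which is a leaf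
    as well.\<close>
  moreover have "f b < 2 ^ height_for n" for b
    using f by (cases "b < n") (auto simp: PiE_dflt_def)
  ultimately show ?case
    by (simp add: oram_ok_def writing_ok_def stored_ok_def above_def)
next
  case (Cons a as)
  then obtain s' H' y where *: "(s', H') \<in> set_pmf (traced_run sel n as)" "y < 2 ^ tree_height s'"
      "s = access_step sel a s' y" "H = (a, label s' a) # H'"
    by (auto simp: access_eq)
  then show ?case
    using Cons.IH[of s' H'] oram_ok_access_step[OF assms(1), of s' H' a y] by auto
qed

text \<open>The value read at \<open>a\<close> is uniform and independent of the other coordinates,
  and so is the value that replaces it. Splitting off coordinate \<open>a\<close> and exchanging the
  two draws gives the equality.\<close>

lemma Pi_pmf_resample:
  assumes "finite A" "a \<in> A"
  shows "do {f \<leftarrow> Pi_pmf A d (\<lambda>_. U); y \<leftarrow> U; g (f a) (f(a := y))} =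
         do {x \<leftarrow> U; f \<leftarrow> Pi_pmf A d (\<lambda>_. U); g x f}"
proof -
  have *: "Pi_pmf A d (\<lambda>_. U) = do {y \<leftarrow> U; f \<leftarrow> Pi_pmf (A - {a}) d (\<lambda>_. U); return_pmf (f(a := y))}"
    using Pi_pmf_insert'[of "A - {a}" a d "\<lambda>_. U"] assms by (simp add: insert_absorb)
  show ?thesis
    unfolding * by (simp add: bind_assoc_pmf bind_return_pmf)
      (subst bind_commute_pmf, rule refl)
qed

text \<open>A label enters the history exactly when it is replaced by a fresh one, and write-back
  changes no label. Hence past paths and current labels stay independent, whatever the selection
  rule does.\<close>

lemma labels_history_law:
  assumes sel: "valid_selection sel" and "set as \<subseteq> {..<n}"
  shows "map_pmf (\<lambda>t. (snd t, label (fst t))) (traced_run sel n as) =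
    pair_pmf (history (height_for n) as) (Pi_pmf {..<n} 0 (\<lambda>_. pmf_of_set {..<2 ^ height_for n}))"
  using assms(2)
proof (induction as)
  case Nil
  then show ?case
    by (simp add: init_oram_def pair_return_pmf1 pmf.map_comp o_def)
next
  case (Cons a as)
  define U where "U = pmf_of_set {..<(2::nat) ^ height_for n}"
  define P where "P = Pi_pmf {..<n} (0::nat) (\<lambda>_. U)"
  define g where "g = (\<lambda>H f. do {y \<leftarrow> U; return_pmf ((a, f a) # H, f(a := y))})"
  have IH: "map_pmf (\<lambda>t. (snd t, label (fst t))) (traced_run sel n as) =
      pair_pmf (history (height_for n) as) P"
    using Cons by (simp add: P_def U_def)
  \<comment> \<open>The effect of an access on history and labels depends on the state only through
    these two, and is \<open>g\<close>.\<close>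
  have "map_pmf (\<lambda>t. (snd t, label (fst t))) (traced_run sel n (a # as)) =
      traced_run sel n as \<bind> (\<lambda>t. g (snd t) (label (fst t)))"
    unfolding traced_run.simps map_bind_pmf
    by (intro bind_pmf_cong refl)
      (auto simp: access_eq pmf.map_comp o_def g_def map_pmf_def bind_return_pmf bind_assoc_pmf U_def
        dest: set_traced_run[OF sel] simp del: fun_upd_apply)
  also have "\<dots> = map_pmf (\<lambda>t. (snd t, label (fst t))) (traced_run sel n as) \<bind> (\<lambda>(H, f). g H f)"
    by (simp add: map_pmf_def bind_assoc_pmf bind_return_pmf)
  also have "\<dots> = do {H \<leftarrow> history (height_for n) as; f \<leftarrow> P; y \<leftarrow> U; return_pmf ((a, f a) # H, f(a := y))}"
    unfolding IH by (simp add: pair_pmf_def bind_assoc_pmf bind_return_pmf g_def)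
  also have "\<dots> = do {H \<leftarrow> history (height_for n) as; x \<leftarrow> U; f \<leftarrow> P; return_pmf ((a, x) # H, f)}"
    using Cons.prems unfolding P_def
    by (intro bind_pmf_cong refl Pi_pmf_resample[of _ _ 0 U "\<lambda>x f. return_pmf ((a, x) # _, f)"]) auto
  also have "\<dots> = do {x \<leftarrow> U; H \<leftarrow> history (height_for n) as; f \<leftarrow> P; return_pmf ((a, x) # H, f)}"
    by (rule bind_commute_pmf)
  also have "\<dots> = pair_pmf (history (height_for n) (a # as)) P"
    by (simp add: pair_pmf_def bind_assoc_pmf bind_return_pmf U_def)
  finally show ?case
    by (simp add: P_def U_def)
qed


subsection \<open>Exponential moments of the numbers of cold blocks\<close>

text \<open>If the members of \<open>D\<close> and the set \<open>Q\<close> are pairwise disjoint,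
  this is \<open>5/3\<close> to the power of the sum of \<open>X u\<close> over the regions in
  \<open>D\<close> plus the number of accessed blocks labelled in \<open>Q\<close>. As a product
  over blocks it can use the independence of the labels.\<close>

definition weight :: "nat set set \<Rightarrow> nat set \<Rightarrow> (nat \<times> nat) list \<Rightarrow> (nat \<Rightarrow> nat) \<Rightarrow> real" where
  "weight D Q H f =
     (\<Prod>b\<in>fst ` set H. if f b \<in> \<Union>{r \<in> D. cold r b H} \<union> Q then 5 / 3 else 1)"

lemma weight_nonneg: "weight D Q H f \<ge> 0"
  by (auto simp: weight_def intro!: prod_nonneg)

lemma prod_if_power:
  fixes c :: real
  assumes "finite B"
  shows "(\<Prod>b\<in>B. if P b then c else 1) = c ^ card {b \<in> B. P b}"
  using assms by (simp add: prod.inter_filter[symmetric])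

text \<open>By disjointness a label meets at most one of the two conditions, so the factors of each
  block multiply.\<close>

lemma weight_insert_region:
  assumes "r \<inter> (\<Union>D \<union> Q) = {}"
  shows "weight (insert r D) Q H f =
    weight D Q H f * (5 / 3) ^ card {b \<in> fst ` set H. f b \<in> r \<and> cold r b H}"
proof -
  have "weight (insert r D) Q H f = (\<Prod>b\<in>fst ` set H.
      (if f b \<in> \<Union>{r \<in> D. cold r b H} \<union> Q then 5 / 3 else 1) *
      (if f b \<in> r \<and> cold r b H then 5 / 3 else 1))"
    unfolding weight_def by (intro prod.cong refl) (use assms in auto)
  then show ?thesis
    by (simp add: prod.distrib weight_def prod_if_power)
qed

lemma weight_insert_label:
  assumes "q \<notin> \<Union>D \<union> Q"
  shows "weight D (insert q Q) H f = weight D Q H f * (5 / 3) ^ card {b \<in> fst ` set H. f b = q}"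
proof -
  have "weight D (insert q Q) H f = (\<Prod>b\<in>fst ` set H.
      (if f b \<in> \<Union>{r \<in> D. cold r b H} \<union> Q then 5 / 3 else 1) * (if f b = q then 5 / 3 else 1))"
    unfolding weight_def by (intro prod.cong refl) (use assms in auto)
  then show ?thesis
    by (simp add: prod.distrib weight_def prod_if_power)
qed

lemma nn_integral_uniform:
  fixes g :: "nat \<Rightarrow> real"
  assumes "\<And>x. g x \<ge> 0"
  shows "(\<integral>\<^sup>+x. ennreal (g x) \<partial>pmf_of_set {..<(2::nat) ^ h}) = ennreal ((\<Sum>x<2 ^ h. g x) / 2 ^ h)"
proof -
  have ne: "{..<(2::nat) ^ h} \<noteq> {}"
    by (auto simp: lessThan_empty_iff)
  have "(\<integral>\<^sup>+x. ennreal (g x) \<partial>pmf_of_set {..<(2::nat) ^ h}) =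
      ennreal (measure_pmf.expectation (pmf_of_set {..<(2::nat) ^ h}) g)"
    using assms ne by (intro nn_integral_eq_integral integrable_measure_pmf_finite) auto
  then show ?thesis
    using ne by (simp add: integral_pmf_of_set)
qed

text \<open>The coefficient \<open>2/3\<close> is the excess of \<open>5/3\<close> over 1, gained
  with probability \<open>card R / 2 ^ h\<close>.\<close>

lemma nn_integral_two_valued:
  assumes "R \<subseteq> {..<2 ^ h}"
  shows "(\<integral>\<^sup>+y. ennreal (if y \<in> R then 5 / 3 else 1) \<partial>pmf_of_set {..<(2::nat) ^ h}) =
    ennreal (1 + 2 / 3 * (real (card R) / 2 ^ h))"
proof -
  have R: "finite R" using assms finite_subset by blast
  have "(\<Sum>y<2 ^ h. if y \<in> R then 5 / 3 else 1) = (\<Sum>y<2 ^ h. 1 + (if y \<in> R then 2 / 3 else (0::real)))"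
    by (intro sum.cong) auto
  also have "\<dots> = 2 ^ h + 2 / 3 * card R"
    using assms R by (simp add: sum.distrib sum.If_cases Int_absorb1)
  finally have "(\<Sum>y<2 ^ h. if y \<in> R then 5 / 3 else 1) = 2 ^ h + 2 / 3 * real (card R)" .
  then show ?thesis
    by (subst nn_integral_uniform) (auto simp: add_divide_distrib)
qed

text \<open>For a fixed history the factor of a block depends on its own label only, so independence
  turns the expectation of the product into a product of expectations.\<close>

lemma nn_integral_weight_labels:
  assumes H: "fst ` set H \<subseteq> {..<n}" and sub: "\<Union>D \<union> Q \<subseteq> {..<2 ^ h}"
  shows "(\<integral>\<^sup>+f. ennreal (weight D Q H f) \<partial>Pi_pmf {..<n} 0 (\<lambda>_. pmf_of_set {..<2 ^ h})) =
    ennreal (\<Prod>b\<in>fst ` set H. 1 + 2 / 3 * (real (card (\<Union>{r \<in> D. cold r b H} \<union> Q)) / 2 ^ h))"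
proof -
  define R where "R b = \<Union>{r \<in> D. cold r b H} \<union> Q" for b
  have R: "R b \<subseteq> {..<2 ^ h}" for b
    using sub by (auto simp: R_def)
  define F where "F b y = ennreal (if b \<in> fst ` set H then if y \<in> R b then 5 / 3 else 1 else 1)" for b y
  have int: "nn_integral (pmf_of_set {..<(2::nat) ^ h}) (F b) =
      ennreal (if b \<in> fst ` set H then 1 + 2 / 3 * (real (card (R b)) / 2 ^ h) else 1)" for b
    unfolding F_def using nn_integral_two_valued[OF R, of b] by (cases "b \<in> fst ` set H") auto
  have "ennreal (weight D Q H f) = (\<Prod>b<n. F b (f b))" for f
  proof -
    have "weight D Q H f = (\<Prod>b<n. if b \<in> fst ` set H then if f b \<in> R b then 5 / 3 else 1 else 1)"
      unfolding weight_def R_def[symmetric] using H by (intro prod.mono_neutral_cong_left) auto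
    then show ?thesis
      by (simp add: F_def prod_ennreal)
  qed
  then have "(\<integral>\<^sup>+f. ennreal (weight D Q H f) \<partial>Pi_pmf {..<n} 0 (\<lambda>_. pmf_of_set {..<2 ^ h})) =
      (\<Prod>b<n. nn_integral (pmf_of_set {..<(2::nat) ^ h}) (F b))"
    by (simp add: nn_integral_prod_Pi_pmf)
  also have "\<dots> = ennreal (\<Prod>b<n. if b \<in> fst ` set H then 1 + 2 / 3 * (real (card (R b)) / 2 ^ h) else 1)"
    unfolding int by (rule prod_ennreal) auto
  also have "(\<Prod>b<n. if b \<in> fst ` set H then 1 + 2 / 3 * (real (card (R b)) / 2 ^ h) else 1) =
      (\<Prod>b\<in>fst ` set H. 1 + 2 / 3 * (real (card (R b)) / 2 ^ h))"
    using H by (intro prod.mono_neutral_cong_right) auto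
  finally show ?thesis
    by (simp add: R_def)
qed

text \<open>A leaf lies in at most one region of \<open>D\<close>, so it loses at most one factor 3,
  and \<open>1/3 = 1 - 2/3\<close>.\<close>

lemma sum_power_card_avoiding:
  fixes D :: "nat set set"
  assumes fin: "finite D" and dis: "disjoint D" and sub: "\<Union>D \<subseteq> {..<N}"
  shows "(\<Sum>x<N. (3::real) ^ card {r \<in> D. x \<notin> r}) = 3 ^ card D * (N - 2 / 3 * card (\<Union>D))"
proof -
  have "(3::real) ^ card {r \<in> D. x \<notin> r} = 3 ^ card D * (1 - (if x \<in> \<Union>D then 2 / 3 else 0))" for x
  proof (cases "x \<in> \<Union>D")
    case True
    then obtain r where r: "r \<in> D" "x \<in> r" by blast
    then have "{r \<in> D. x \<notin> r} = D - {r}"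
      using dis by (auto simp: disjoint_def)
    moreover have "card D = Suc (card (D - {r}))"
      using card.remove[OF fin r(1)] .
    ultimately show ?thesis
      using True by simp
  next
    case False
    then have "{r \<in> D. x \<notin> r} = D" by auto
    then show ?thesis using False by simp
  qed
  moreover have "(\<Sum>x<N. if x \<in> \<Union>D then 2 / 3 else (0::real)) = 2 / 3 * card (\<Union>D)"
    using sum.inter_restrict[of "{..<N}" "\<lambda>_. 2 / 3 :: real" "\<Union>D"] sub by (simp add: Int_absorb1)
  ultimately show ?thesis
    by (simp add: sum_distrib_left[symmetric] sum_subtractf)
qed

text \<open>
  The latest access comes first in the history. It leaves every factor of an untouched region as
  it is and removes the factor 3 of a touched one; since \<open>(1 + a (P + q)) (1 - a P) \<le> 1 + a q\<close>
  for \<open>a = 2/3\<close>, this pays for the possible gain of the block accessed.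
\<close>

lemma nn_integral_history:
  fixes D :: "nat set set"
  assumes "finite D" "disjoint D" "\<Union>D \<subseteq> {..<2 ^ h}" "finite Q"
  shows "(\<integral>\<^sup>+H. ennreal (\<Prod>b\<in>fst ` set H - S. 1 + 2 / 3 * (real (card (\<Union>{r \<in> D. cold r b H} \<union> Q)) / 2 ^ h))
      \<partial>history h as) \<le> ennreal (3 ^ card D * (1 + 2 / 3 * (real (card Q) / 2 ^ h)) ^ card (set as - S))"
  using assms(1-3)
proof (induction as arbitrary: D S)
  case Nil
  then show ?case by simp
next
  case (Cons a as)
  define G where "G D S H = (\<Prod>b\<in>fst ` set H - S.
      1 + 2 / 3 * (real (card (\<Union>{r \<in> D. cold r b H} \<union> Q)) / 2 ^ h))" for D S H
  \<comment> \<open>The regions that a path to leaf \<open>x\<close> leaves untouched. The set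
    \<open>S\<close> collects the addresses of later accesses: their factors are already accounted
    for.\<close>
  define D' where "D' x = {r \<in> D. x \<notin> r}" for x
  define q where "q = real (card Q) / 2 ^ h"
  define P where "P = real (card (\<Union>D)) / 2 ^ h"
  define F where "F = (if a \<in> S then 1 else 1 + 2 / 3 * (P + q))"
  define m where "m = card (set as - insert a S)"
  have finD: "finite (\<Union>D)"
    using Cons.prems(3) finite_subset by blast
  have nn: "G D S H \<ge> 0" for D S H
    by (auto simp: G_def intro!: prod_nonneg)
  have q: "q \<ge> 0" and P: "P \<ge> 0"
    by (simp_all add: q_def P_def)
  have F: "F \<ge> 0" using q P by (simp add: F_def)
  \<comment> \<open>If \<open>a\<close> is not in \<open>S\<close>, this is its last access, and its
    factor is bounded as if all of \<open>D\<close> were cold for it. For any other block, only the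
    regions avoiding \<open>x\<close> can stay cold.\<close>
  have G: "G D S ((a, x) # H) \<le> F * G (D' x) (insert a S) H" for x H
  proof -
    have eq: "{r \<in> D. cold r b ((a, x) # H)} = {r \<in> D' x. cold r b H}" if "b \<noteq> a" for b
      using that by (auto simp: D'_def)
    show ?thesis
    proof (cases "a \<in> S")
      case True
      then have "fst ` set ((a, x) # H) - S = fst ` set H - insert a S" by auto
      then have "G D S ((a, x) # H) = G (D' x) (insert a S) H"
        unfolding G_def using eq by (intro prod.cong) auto
      then show ?thesis
        using True by (simp add: F_def)
    next
      case False
      then have set: "fst ` set ((a, x) # H) - S = insert a (fst ` set H - insert a S)" by auto
      have "G D S ((a, x) # H) =
          (1 + 2 / 3 * (real (card (\<Union>{r \<in> D. cold r a ((a, x) # H)} \<union> Q)) / 2 ^ h)) * G (D' x) (insert a S) H"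
        unfolding G_def set using eq by (subst prod.insert) (auto intro!: prod.cong)
      moreover have "card (\<Union>{r \<in> D. cold r a ((a, x) # H)} \<union> Q) \<le> card (\<Union>D) + card Q"
        by (rule order_trans[OF card_Un_le])
          (auto intro!: add_right_mono card_mono finD)
      then have "real (card (\<Union>{r \<in> D. cold r a ((a, x) # H)} \<union> Q)) / 2 ^ h \<le> P + q"
        by (simp add: P_def q_def field_simps flip: of_nat_add)
      ultimately show ?thesis
        using False nn by (auto simp: F_def intro!: mult_right_mono)
    qed
  qed
  have "(\<integral>\<^sup>+H. ennreal (G D S ((a, x) # H)) \<partial>history h as) \<le> ennreal (F * (1 + 2 / 3 * q) ^ m * 3 ^ card (D' x))"
    for x
  proof -
    have "(\<integral>\<^sup>+H. ennreal (G D S ((a, x) # H)) \<partial>history h as) \<le>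
        (\<integral>\<^sup>+H. ennreal F * ennreal (G (D' x) (insert a S) H) \<partial>history h as)"
      using G F by (intro nn_integral_mono) (auto simp: ennreal_mult'[symmetric] intro!: ennreal_leI)
    also have "\<dots> = ennreal F * (\<integral>\<^sup>+H. ennreal (G (D' x) (insert a S) H) \<partial>history h as)"
      by (rule nn_integral_cmult) auto
    also have "\<dots> \<le> ennreal F * ennreal (3 ^ card (D' x) * (1 + 2 / 3 * q) ^ m)"
      unfolding G_def q_def m_def
      by (intro mult_left_mono Cons.IH) (use Cons.prems in \<open>auto simp: D'_def disjoint_def\<close>)
    finally show ?thesis
      using F by (simp add: ennreal_mult'[symmetric] mult_ac)
  qed
  then have "(\<integral>\<^sup>+H. ennreal (G D S H) \<partial>history h (a # as)) \<le>
      (\<integral>\<^sup>+x. ennreal (F * (1 + 2 / 3 * q) ^ m * 3 ^ card (D' x)) \<partial>pmf_of_set {..<(2::nat) ^ h})"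
    by (auto intro!: nn_integral_mono)
  also have "\<dots> = ennreal ((\<Sum>x<2 ^ h. F * (1 + 2 / 3 * q) ^ m * 3 ^ card (D' x)) / 2 ^ h)"
    using F q by (intro nn_integral_uniform) auto
  also have "(\<Sum>x<2 ^ h. F * (1 + 2 / 3 * q) ^ m * 3 ^ card (D' x)) / 2 ^ h =
      F * (1 + 2 / 3 * q) ^ m * 3 ^ card D * (1 - 2 / 3 * P)"
    unfolding sum_distrib_left[symmetric] D'_def sum_power_card_avoiding[OF Cons.prems]
    by (simp add: P_def field_simps)
  also have "\<dots> = (F * (1 - 2 / 3 * P)) * ((1 + 2 / 3 * q) ^ m * 3 ^ card D)"
    by (simp add: mult_ac)
  also have "\<dots> \<le> (if a \<in> S then 1 else 1 + 2 / 3 * q) * ((1 + 2 / 3 * q) ^ m * 3 ^ card D)"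
  proof (intro mult_right_mono)
    have "(1 + 2 / 3 * (P + q)) * (1 - 2 / 3 * P) = 1 + 2 / 3 * q - 4 / 9 * (P * P) - 4 / 9 * (P * q)"
      by (simp add: field_simps)
    also have "\<dots> \<le> 1 + 2 / 3 * q"
      using P q mult_nonneg_nonneg[OF P P] mult_nonneg_nonneg[OF P q] by linarith
    finally show "F * (1 - 2 / 3 * P) \<le> (if a \<in> S then 1 else 1 + 2 / 3 * q)"
      using P by (simp add: F_def)
  qed (use q in auto)
  also have "\<dots> = 3 ^ card D * (1 + 2 / 3 * q) ^ card (set (a # as) - S)"
  proof (cases "a \<in> S")
    case True
    then have "set (a # as) - S = set as - insert a S" by auto
    then have "card (set (a # as) - S) = m"
      by (simp only: m_def)
    then show ?thesis using True by (simp add: mult_ac del: set_simps)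
  next
    case False
    then have "set (a # as) - S = insert a (set as - insert a S)" by auto
    then have "card (set (a # as) - S) = Suc m"
      by (simp add: m_def)
    then show ?thesis using False by (simp add: mult_ac del: set_simps)
  qed
  finally show ?case
    by (auto simp: G_def q_def ennreal_leI)
qed

text \<open>Averaging over the labels and then over the history leaves \<open>3 ^ card D\<close> and
  one factor close to 1 per accessed address. There are at most as many addresses as leaves, so
  these factors multiply to at most \<open>exp (2/3) ^ card Q\<close>.\<close>

lemma nn_integral_weight:
  assumes as: "set as \<subseteq> {..<n}" and n: "n \<le> 2 ^ h"
    and D: "finite D" "disjoint D" and sub: "\<Union>D \<union> Q \<subseteq> {..<2 ^ h}"
  shows "(\<integral>\<^sup>+t. ennreal (weight D Q (fst t) (snd t))
      \<partial>pair_pmf (history h as) (Pi_pmf {..<n} 0 (\<lambda>_. pmf_of_set {..<2 ^ h}))) \<le>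
    ennreal (3 ^ (card D + card Q))"
proof -
  define N where "N = (2::nat) ^ h"
  have N: "real N > 0" by (simp add: N_def)
  have Q: "finite Q"
    using sub finite_subset by auto
  have "map fst H = as" if "H \<in> set_pmf (history h as)" for H
    using that by (induction as arbitrary: H) auto
  then have H: "fst ` set H = set as" if "H \<in> set_pmf (history h as)" for H
    using that unfolding set_map[symmetric] by simp
  have "(\<integral>\<^sup>+t. ennreal (weight D Q (fst t) (snd t))
      \<partial>pair_pmf (history h as) (Pi_pmf {..<n} 0 (\<lambda>_. pmf_of_set {..<2 ^ h}))) =
    (\<integral>\<^sup>+H. (\<integral>\<^sup>+f. ennreal (weight D Q H f) \<partial>Pi_pmf {..<n} 0 (\<lambda>_. pmf_of_set {..<2 ^ h})) \<partial>history h as)"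
    by (simp add: nn_integral_pair_pmf')
  also have "\<dots> = (\<integral>\<^sup>+H. ennreal (\<Prod>b\<in>fst ` set H - {}. 1 + 2 / 3 * (real (card (\<Union>{r \<in> D. cold r b H} \<union> Q)) / 2 ^ h))
      \<partial>history h as)"
    using as sub by (intro nn_integral_cong_AE AE_pmfI, subst nn_integral_weight_labels) (auto simp: H)
  also have "\<dots> \<le> ennreal (3 ^ card D * (1 + 2 / 3 * (real (card Q) / 2 ^ h)) ^ card (set as - {}))"
    using D sub Q by (intro nn_integral_history) auto
  also have "\<dots> \<le> ennreal (3 ^ card D * 3 ^ card Q)"
  proof (intro ennreal_leI mult_left_mono)
    have "card (set as - {}) \<le> N"
      using card_mono[OF _ as] n by (simp add: N_def)
    then have "(1 + 2 / 3 * (real (card Q) / N)) ^ card (set as - {}) \<le> (1 + 2 / 3 * (real (card Q) / N)) ^ N"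
      by (intro power_increasing) auto
    also have "\<dots> \<le> exp (2 / 3 * (real (card Q) / N)) ^ N"
      by (intro power_mono exp_ge_add_one_self) auto
    also have "\<dots> = exp (real N * (2 / 3 * (real (card Q) / N)))"
      by (rule exp_of_nat_mult[symmetric])
    also have "real N * (2 / 3 * (real (card Q) / N)) = real (card Q) * (2 / 3)"
      using N by simp
    also have "exp \<dots> = exp (2 / 3) ^ card Q"
      by (rule exp_of_nat_mult)
    also have "\<dots> \<le> 3 ^ card Q"
      using order_trans[OF _ exp_le, of "exp (2 / 3)"] by (intro power_mono) simp_all
    finally show "(1 + 2 / 3 * (real (card Q) / 2 ^ h)) ^ card (set as - {}) \<le> 3 ^ card Q"
      by (simp add: N_def)
  qed auto
  finally show ?thesis
    by (simp add: power_add)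
qed


subsection \<open>The stash of one ORAM\<close>

text \<open>\<open>\<Psi>\<close> collects the powers of \<open>5/3\<close> for subtrees already
  treated, and \<open>r\<close> is the set of leaves still free. A further weight supported in
  \<open>r\<close> must cost at most 3 per region or label, which lets the bound be applied to one
  subtree after another.\<close>

definition tame ::
  "(oram \<times> (nat \<times> nat) list) pmf \<Rightarrow> nat set \<Rightarrow> ennreal \<Rightarrow> (oram \<times> (nat \<times> nat) list \<Rightarrow> ennreal) \<Rightarrow> bool"
where
  "tame p r \<kappa> \<Psi> \<longleftrightarrow>
     (\<forall>D Q. finite D \<longrightarrow> disjoint D \<longrightarrow> finite Q \<longrightarrow> \<Union>D \<union> Q \<subseteq> r \<longrightarrow> \<Union>D \<inter> Q = {} \<longrightarrow>
        (\<integral>\<^sup>+t. \<Psi> t * ennreal (weight D Q (snd t) (label (fst t))) \<partial>p) \<le> \<kappa> * 3 ^ (card D + card Q))"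

lemma tameD:
  assumes "tame p r \<kappa> \<Psi>" "finite D" "disjoint D" "finite Q" "\<Union>D \<union> Q \<subseteq> r" "\<Union>D \<inter> Q = {}"
  shows "(\<integral>\<^sup>+t. \<Psi> t * ennreal (weight D Q (snd t) (label (fst t))) \<partial>p) \<le> \<kappa> * 3 ^ (card D + card Q)"
  using assms unfolding tame_def by blast

text \<open>The alternative becomes a sum, which can be integrated. The constant is
  \<open>5/3\<close> to the power of minus \<open>bucket_size\<close>.\<close>

lemma power_excess_le:
  fixes k x y :: nat
  assumes "k \<le> x \<or> k + bucket_size \<le> y"
  shows "(5 / 3 :: real) ^ k \<le> (5 / 3) ^ x + (3 / 5) ^ 5 * (5 / 3) ^ y"
  using assms
proof
  assume "k \<le> x"
  then have "(5 / 3 :: real) ^ k \<le> (5 / 3) ^ x"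
    by (intro power_increasing) auto
  then show ?thesis
    by (simp add: add_increasing2)
next
  assume "k + bucket_size \<le> y"
  then have "(5 / 3 :: real) ^ (k + 5) \<le> (5 / 3) ^ y"
    by (intro power_increasing) (auto simp: bucket_size_def)
  then have "(3 / 5 :: real) ^ 5 * (5 / 3) ^ (k + 5) \<le> (3 / 5) ^ 5 * (5 / 3) ^ y"
    by (intro mult_left_mono) auto
  also have "(3 / 5 :: real) ^ 5 * (5 / 3) ^ (k + 5) = (5 / 3) ^ k"
    by (simp add: power_add power_divide)
  finally show ?thesis
    by (simp add: add_increasing)
qed

text \<open>This closes the recursion: 3 pays for one more region, \<open>36 = 6 * 6\<close> for two
  children, and \<open>3 + (3/5)^5 * 36\<close> is about 5.8.\<close>

lemma nn_integral_le_add_scaled: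
  fixes F G E :: "'a \<Rightarrow> ennreal"
  assumes "\<And>t. t \<in> set_pmf p \<Longrightarrow> F t \<le> G t + ennreal ((3 / 5) ^ 5) * E t"
    and "(\<integral>\<^sup>+t. G t \<partial>p) \<le> 3 * \<kappa>" and "(\<integral>\<^sup>+t. E t \<partial>p) \<le> 36 * \<kappa>"
  shows "(\<integral>\<^sup>+t. F t \<partial>p) \<le> 6 * \<kappa>"
proof -
  have "(\<integral>\<^sup>+t. F t \<partial>p) \<le> (\<integral>\<^sup>+t. G t + ennreal ((3 / 5) ^ 5) * E t \<partial>p)"
    using assms(1) by (intro nn_integral_mono_AE AE_pmfI)
  also have "\<dots> = (\<integral>\<^sup>+t. G t \<partial>p) + ennreal ((3 / 5) ^ 5) * (\<integral>\<^sup>+t. E t \<partial>p)"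
    by (simp add: nn_integral_add nn_integral_cmult)
  also have "\<dots> \<le> 3 * \<kappa> + ennreal ((3 / 5) ^ 5) * (36 * \<kappa>)"
    by (intro add_mono mult_left_mono assms) auto
  also have "\<dots> = (3 + ennreal ((3 / 5) ^ 5) * 36) * \<kappa>"
    by (simp add: distrib_right mult.assoc)
  also have "3 + ennreal ((3 / 5) ^ 5) * 36 = ennreal (3 + (3 / 5) ^ 5 * 36)"
    by (subst ennreal_plus) (auto simp: ennreal_mult)
  also have "\<dots> \<le> ennreal 6"
    by (intro ennreal_leI) (simp add: power_divide)
  finally show ?thesis
    by (simp add: mult_right_mono)
qed

text \<open>Induction from the leaves to the root. The cold term adds the region of the node to
  \<open>D\<close>; the other term applies the induction hypothesis to both children in turn. The
  second use has the factor of the first child inside \<open>\<Psi>\<close>, hence the general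
  \<open>\<Psi>\<close> and \<open>r\<close>.\<close>

lemma tame_waiting:
  assumes ok: "\<And>s H. (s, H) \<in> set_pmf p \<Longrightarrow> oram_ok s H \<and> tree_height s = L"
    and l: "l \<le> L" and "tame p r \<kappa> \<Psi>" and "region L l v \<subseteq> r"
  shows "tame p (r - region L l v) (6 * \<kappa>) (\<lambda>t. \<Psi> t * ennreal ((5 / 3) ^ card (waiting (fst t) l v)))"
  using l assms(3,4)
proof (induction l arbitrary: v r \<kappa> \<Psi> rule: inc_induct)
  case base
  show ?case
    unfolding tame_def
  proof (intro allI impI)
    fix D Q assume D: "finite D" "disjoint D" "finite Q" "\<Union>D \<union> Q \<subseteq> r - region L L v" "\<Union>D \<inter> Q = {}"
    have v: "region L L v = {v}" by (auto simp: region_def)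
    have dis: "{v} \<inter> (\<Union>D \<union> Q) = {}" using D(4) v by auto
    show "(\<integral>\<^sup>+t. \<Psi> t * ennreal ((5 / 3) ^ card (waiting (fst t) L v)) *
        ennreal (weight D Q (snd t) (label (fst t))) \<partial>p) \<le> 6 * \<kappa> * 3 ^ (card D + card Q)"
      unfolding mult.assoc[of 6]
    proof (rule nn_integral_le_add_scaled)
      fix t assume t: "t \<in> set_pmf p"
      obtain s H where st: "t = (s, H)" by (cases t)
      let ?w = "weight D Q H (label s)"
      have "(5 / 3) ^ card (waiting s L v) * ?w \<le>
          ((5 / 3) ^ card (cold_blocks s H {v}) +
            (3 / 5) ^ 5 * (5 / 3) ^ card {b \<in> fst ` set H. label s b = v}) * ?w"
        using waiting_leaf[of s H v] ok[of s H] t st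
        by (intro mult_right_mono power_excess_le weight_nonneg) auto
      also have "\<dots> = weight (insert {v} D) Q H (label s) + (3 / 5) ^ 5 * weight D (insert v Q) H (label s)"
        using weight_insert_region[of "{v}" D Q H "label s"] weight_insert_label[of v D Q H "label s"] dis
        by (simp add: cold_blocks_def algebra_simps)
      finally have "\<Psi> t * ennreal ((5 / 3) ^ card (waiting s L v) * ?w) \<le> \<Psi> t *
          ennreal (weight (insert {v} D) Q H (label s) + (3 / 5) ^ 5 * weight D (insert v Q) H (label s))"
        by (intro mult_left_mono ennreal_leI) auto
      then show "\<Psi> t * ennreal ((5 / 3) ^ card (waiting (fst t) L v)) *
          ennreal (weight D Q (snd t) (label (fst t))) \<le>
        \<Psi> t * ennreal (weight (insert {v} D) Q (snd t) (label (fst t))) +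
        ennreal ((3 / 5) ^ 5) * (\<Psi> t * ennreal (weight D (insert v Q) (snd t) (label (fst t))))"
        by (simp add: st ennreal_mult weight_nonneg distrib_left mult_ac)
    next
      have "(\<integral>\<^sup>+t. \<Psi> t * ennreal (weight (insert {v} D) Q (snd t) (label (fst t))) \<partial>p) \<le>
          \<kappa> * 3 ^ (card (insert {v} D) + card Q)"
        using D dis base.prems(2) v by (intro tameD[OF base.prems(1)]) (auto simp: disjoint_def)
      also have "\<dots> \<le> \<kappa> * 3 ^ Suc (card D + card Q)"
        using D(1) by (intro mult_left_mono power_increasing) (auto simp: card_insert_if)
      finally show "(\<integral>\<^sup>+t. \<Psi> t * ennreal (weight (insert {v} D) Q (snd t) (label (fst t))) \<partial>p) \<le>
          3 * (\<kappa> * 3 ^ (card D + card Q))"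
        by (simp add: mult_ac)
    next
      have "(\<integral>\<^sup>+t. \<Psi> t * ennreal (weight D (insert v Q) (snd t) (label (fst t))) \<partial>p) \<le>
          \<kappa> * 3 ^ (card D + card (insert v Q))"
        using D dis base.prems(2) v by (intro tameD[OF base.prems(1)]) auto
      \<comment> \<open>One more label costs a factor 3, so a leaf fits the bound 36 meant for two
        children.\<close>
      also have "\<dots> \<le> \<kappa> * (36 * 3 ^ (card D + card Q))"
        using D(3) dis by (intro mult_left_mono) (auto simp: power_add intro!: mult_right_mono)
      finally show "(\<integral>\<^sup>+t. \<Psi> t * ennreal (weight D (insert v Q) (snd t) (label (fst t))) \<partial>p) \<le>
          36 * (\<kappa> * 3 ^ (card D + card Q))"
        by (simp add: mult_ac)
    qed
  qed
next
  case (step l)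
  define R where "R = region L l v"
  define R0 where "R0 = region L (Suc l) (2 * v)"
  define R1 where "R1 = region L (Suc l) (2 * v + 1)"
  have R: "R = R0 \<union> R1" and R01: "R0 \<inter> R1 = {}"
    using region_split[OF step.hyps(2), of v] by (auto simp: R_def R0_def R1_def region_def)
  have sub: "R \<subseteq> r" using step.prems(2) by (simp add: R_def)
  define c where "c u t = ennreal ((5 / 3) ^ card (waiting (fst t) (Suc l) u))"
    for u and t :: "oram \<times> (nat \<times> nat) list"
  have "tame p (r - R0) (6 * \<kappa>) (\<lambda>t. \<Psi> t * c (2 * v) t)"
    unfolding R0_def c_def using sub R R0_def by (intro step.IH step.prems(1)) auto
  \<comment> \<open>The region of the right child is still free, since the two children have
    disjoint regions.\<close>
  then have "tame p (r - R0 - R1) (6 * (6 * \<kappa>)) (\<lambda>t. \<Psi> t * c (2 * v) t * c (2 * v + 1) t)"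
    unfolding R1_def c_def using sub R R01 R1_def by (intro step.IH) auto
  then have tame2: "tame p (r - R) (36 * \<kappa>) (\<lambda>t. \<Psi> t * c (2 * v) t * c (2 * v + 1) t)"
    by (simp add: R Diff_eq Int_assoc flip: mult.assoc)
  show ?case
    unfolding tame_def R_def[symmetric]
  proof (intro allI impI)
    fix D Q assume D: "finite D" "disjoint D" "finite Q" "\<Union>D \<union> Q \<subseteq> r - R" "\<Union>D \<inter> Q = {}"
    have dis: "R \<inter> (\<Union>D \<union> Q) = {}" using D(4) by auto
    show "(\<integral>\<^sup>+t. \<Psi> t * ennreal ((5 / 3) ^ card (waiting (fst t) l v)) *
        ennreal (weight D Q (snd t) (label (fst t))) \<partial>p) \<le> 6 * \<kappa> * 3 ^ (card D + card Q)"
      unfolding mult.assoc[of 6]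
    proof (rule nn_integral_le_add_scaled)
      fix t assume t: "t \<in> set_pmf p"
      obtain s H where st: "t = (s, H)" by (cases t)
      let ?w = "weight D Q H (label s)"
      have "(5 / 3) ^ card (waiting s l v) * ?w \<le>
          ((5 / 3) ^ card (cold_blocks s H R) +
            (3 / 5) ^ 5 * (5 / 3) ^ (card (waiting s (Suc l) (2 * v)) + card (waiting s (Suc l) (2 * v + 1)))) * ?w"
        using waiting_split[of s H l v] ok[of s H] t st step.hyps(2)
        by (intro mult_right_mono power_excess_le weight_nonneg) (auto simp: R_def)
      also have "\<dots> = weight (insert R D) Q H (label s) +
          (3 / 5) ^ 5 * ((5 / 3) ^ card (waiting s (Suc l) (2 * v)) *
            (5 / 3) ^ card (waiting s (Suc l) (2 * v + 1)) * ?w)"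
        using weight_insert_region[of R D Q H "label s"] dis
        by (simp add: cold_blocks_def algebra_simps power_add)
      finally have "\<Psi> t * ennreal ((5 / 3) ^ card (waiting s l v) * ?w) \<le> \<Psi> t *
          ennreal (weight (insert R D) Q H (label s) +
            (3 / 5) ^ 5 * ((5 / 3) ^ card (waiting s (Suc l) (2 * v)) *
            (5 / 3) ^ card (waiting s (Suc l) (2 * v + 1)) * ?w))"
        by (intro mult_left_mono ennreal_leI) auto
      then show "\<Psi> t * ennreal ((5 / 3) ^ card (waiting (fst t) l v)) *
          ennreal (weight D Q (snd t) (label (fst t))) \<le>
        \<Psi> t * ennreal (weight (insert R D) Q (snd t) (label (fst t))) +
        ennreal ((3 / 5) ^ 5) * (\<Psi> t * c (2 * v) t * c (2 * v + 1) t *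
          ennreal (weight D Q (snd t) (label (fst t))))"
        by (simp add: st c_def ennreal_mult weight_nonneg distrib_left mult_ac)
    next
      have "(\<integral>\<^sup>+t. \<Psi> t * ennreal (weight (insert R D) Q (snd t) (label (fst t))) \<partial>p) \<le>
          \<kappa> * 3 ^ (card (insert R D) + card Q)"
        using D dis sub by (intro tameD[OF step.prems(1)]) (auto simp: disjoint_def)
      also have "\<dots> \<le> \<kappa> * 3 ^ Suc (card D + card Q)"
        using D(1) by (intro mult_left_mono power_increasing) (auto simp: card_insert_if)
      finally show "(\<integral>\<^sup>+t. \<Psi> t * ennreal (weight (insert R D) Q (snd t) (label (fst t))) \<partial>p) \<le>
          3 * (\<kappa> * 3 ^ (card D + card Q))"
        by (simp add: mult_ac)
    next
      show "(\<integral>\<^sup>+t. \<Psi> t * c (2 * v) t * c (2 * v + 1) t *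
          ennreal (weight D Q (snd t) (label (fst t))) \<partial>p) \<le> 36 * (\<kappa> * 3 ^ (card D + card Q))"
        using tameD[OF tame2 D] by (simp add: mult_ac)
    qed
  qed
qed

lemma le_power_height_for: "n \<le> 2 ^ height_for n"
proof (cases "n = 0")
  case False
  have "real n = 2 powr log 2 n"
    using False by simp
  also have "\<dots> \<le> 2 powr height_for n"
    unfolding height_for_def by (intro powr_mono) (auto simp: le_nat_iff, linarith)
  also have "\<dots> = real (2 ^ height_for n)"
    by (simp add: powr_realpow)
  finally show ?thesis
    by (simp only: of_nat_le_iff)
qed simp

text \<open>With \<open>\<Psi> = 1\<close> and all leaves free, tameness is the moment bound for
  weights. No bucket lies above the root and every label lies below it, so the blocks waiting there
  form the stash.\<close>

lemma nn_integral_stash_traced_run: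
  assumes sel: "valid_selection sel" and as: "set as \<subseteq> {..<n}"
  shows "(\<integral>\<^sup>+t. ennreal ((5 / 3) ^ card (stash (fst t))) \<partial>traced_run sel n as) \<le> 6"
proof -
  define L where "L = height_for n"
  define p where "p = traced_run sel n as"
  have region: "region L 0 0 = {..<2 ^ L}"
    by (auto simp: region_def div_eq_0_iff)
  have "tame p {..<2 ^ L} 1 (\<lambda>_. 1)"
    unfolding tame_def
  proof (intro allI impI)
    fix D Q assume D: "finite D" "disjoint D" "\<Union>D \<union> Q \<subseteq> {..<(2::nat) ^ L}"
    have "(\<integral>\<^sup>+t. 1 * ennreal (weight D Q (snd t) (label (fst t))) \<partial>p) =
        (\<integral>\<^sup>+u. ennreal (weight D Q (fst u) (snd u)) \<partial>map_pmf (\<lambda>t. (snd t, label (fst t))) p)"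
      by simp
    also have "\<dots> \<le> ennreal (3 ^ (card D + card Q))"
      unfolding p_def labels_history_law[OF sel as] L_def[symmetric]
      using D le_power_height_for[of n] by (intro nn_integral_weight as) (auto simp: L_def)
    also have "\<dots> = 1 * 3 ^ (card D + card Q)"
      by (simp add: ennreal_power[symmetric])
    finally show "(\<integral>\<^sup>+t. 1 * ennreal (weight D Q (snd t) (label (fst t))) \<partial>p) \<le> 1 * 3 ^ (card D + card Q)" .
  qed
  then have "tame p ({..<2 ^ L} - region L 0 0) (6 * 1)
      (\<lambda>t. 1 * ennreal ((5 / 3) ^ card (waiting (fst t) 0 0)))"
    using set_traced_run[OF sel] by (intro tame_waiting) (auto simp: p_def L_def region[unfolded L_def])
  from tameD[OF this, of "{}" "{}"]
  have "(\<integral>\<^sup>+t. ennreal ((5 / 3) ^ card (waiting (fst t) 0 0)) \<partial>p) \<le> 6"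
    by (simp add: weight_def disjoint_def)
  moreover have "waiting (fst t) 0 0 = stash (fst t)" if "t \<in> set_pmf p" for t
    using set_traced_run[OF sel, of "fst t" "snd t" n as] that region
    by (auto simp: waiting_def above_def p_def L_def)
  ultimately show ?thesis
    unfolding p_def[symmetric]
    by (subst nn_integral_cong_AE[OF AE_pmfI, of _ _ "\<lambda>t. ennreal ((5 / 3) ^ card (waiting (fst t) 0 0))"]) auto
qed


subsection \<open>Independence of the levels of the recursion\<close>

primrec product_list_pmf :: "'a pmf list \<Rightarrow> 'a list pmf" where
  "product_list_pmf [] = return_pmf []"
| "product_list_pmf (p # ps) = do {x \<leftarrow> p; xs \<leftarrow> product_list_pmf ps; return_pmf (x # xs)}"

lemma length_product_list_pmf:
  "xs \<in> set_pmf (product_list_pmf ps) \<Longrightarrow> length xs = length ps"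
  by (induction ps arbitrary: xs) auto

lemma nn_integral_product_list_pmf_le:
  fixes g :: "'a \<Rightarrow> ennreal" and ps :: "'a pmf list"
  assumes "\<And>p. p \<in> set ps \<Longrightarrow> (\<integral>\<^sup>+x. g x \<partial>p) \<le> C"
  shows "(\<integral>\<^sup>+xs. prod_list (map g xs) \<partial>product_list_pmf ps) \<le> C ^ length ps"
  using assms
proof (induction ps)
  case Nil
  then show ?case by simp
next
  case (Cons p ps)
  have "(\<integral>\<^sup>+xs. prod_list (map g xs) \<partial>product_list_pmf (p # ps)) =
      (\<integral>\<^sup>+x. g x \<partial>p) * (\<integral>\<^sup>+xs. prod_list (map g xs) \<partial>product_list_pmf ps)"
    by (simp add: nn_integral_cmult nn_integral_multc)
  also have "\<dots> \<le> C * C ^ length ps"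
    using Cons by (intro mult_mono) auto
  finally show ?case by simp
qed

text \<open>The list of accesses is again in reverse chronological order.\<close>

primrec run :: "selection \<Rightarrow> nat \<Rightarrow> nat list \<Rightarrow> oram pmf" where
  "run sel n [] = init_oram n"
| "run sel n (a # as) = run sel n as \<bind> access sel a"

lemma run_eq_traced_run: "run sel n as = map_pmf fst (traced_run sel n as)"
  by (induction as) (simp_all add: pmf.map_comp o_def map_bind_pmf bind_map_pmf)

lemma nn_integral_stash_run:
  assumes "valid_selection sel" "set as \<subseteq> {..<n}"
  shows "(\<integral>\<^sup>+s. ennreal ((5 / 3) ^ card (stash s)) \<partial>run sel n as) \<le> 6"
  using nn_integral_stash_traced_run[OF assms] by (simp add: run_eq_traced_run)

text \<open>The recursion visits the smaller ORAMs first, but accesses to different levels touch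
  different components, use separate randomness and have fixed addresses \<open>b j\<close>. They
  can be reordered, and the levels remain independent.\<close>

lemma access_rec_product:
  assumes "\<And>j. b (Suc j) = b j div k"
  shows "product_list_pmf (map P [i..<m]) \<bind> access_rec k sel i (b i) =
    product_list_pmf (map (\<lambda>j. P j \<bind> access (sel j) (b j)) [i..<m])"
proof (induction "m - i" arbitrary: i)
  case 0
  then show ?case by (simp add: bind_return_pmf)
next
  case (Suc d)
  then have up: "[i..<m] = i # [Suc i..<m]"
    by (simp add: upt_conv_Cons)
  have IH: "product_list_pmf (map P [Suc i..<m]) \<bind> access_rec k sel (Suc i) (b i div k) =
      product_list_pmf (map (\<lambda>j. P j \<bind> access (sel j) (b j)) [Suc i..<m])"
    using Suc(1)[of "Suc i"] Suc(2) assms[of i] by simp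
  have "product_list_pmf (map P [i..<m]) \<bind> access_rec k sel i (b i) =
      do {s \<leftarrow> P i;
          ss' \<leftarrow> product_list_pmf (map P [Suc i..<m]) \<bind> access_rec k sel (Suc i) (b i div k);
          s' \<leftarrow> access (sel i) (b i) s;
          return_pmf (s' # ss')}"
    by (simp add: up bind_assoc_pmf bind_return_pmf)
  also have "\<dots> = do {s \<leftarrow> P i; s' \<leftarrow> access (sel i) (b i) s;
          ss' \<leftarrow> product_list_pmf (map P [Suc i..<m]) \<bind> access_rec k sel (Suc i) (b i div k);
          return_pmf (s' # ss')}"
    by (intro bind_pmf_cong refl bind_commute_pmf)
  also have "\<dots> = product_list_pmf (map (\<lambda>j. P j \<bind> access (sel j) (b j)) [i..<m])"
    unfolding IH by (simp add: up bind_assoc_pmf)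
  finally show ?case .
qed

text \<open>Every operation extends the access list of each level by one address determined by the
  data address; \<open>bs\<close> holds the accesses made before, latest first.\<close>

lemma operations_product:
  assumes k: "k = labels_per_block chi N"
  shows "product_list_pmf (map (\<lambda>j. run (sel j) (n j) (bs j)) [0..<m]) \<bind> operations chi N sel as =
    product_list_pmf (map (\<lambda>j. run (sel j) (n j) (rev (map (\<lambda>a. a div k ^ j) as) @ bs j)) [0..<m])"
proof (induction as arbitrary: bs)
  case Nil
  then show ?case by (simp add: bind_return_pmf')
next
  case (Cons a as)
  have "operations chi N sel (a # as) = (\<lambda>ss. access_rec k sel 0 (a div k ^ 0) ss \<bind> operations chi N sel as)"
    by (rule ext) (simp add: operation_def k)
  then have "product_list_pmf (map (\<lambda>j. run (sel j) (n j) (bs j)) [0..<m]) \<bind> operations chi N sel (a # as) =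
      product_list_pmf (map (\<lambda>j. run (sel j) (n j) (bs j)) [0..<m]) \<bind>
        access_rec k sel 0 (a div k ^ 0) \<bind> operations chi N sel as"
    by (simp only: bind_assoc_pmf)
  also have "product_list_pmf (map (\<lambda>j. run (sel j) (n j) (bs j)) [0..<m]) \<bind>
        access_rec k sel 0 (a div k ^ 0) =
      product_list_pmf (map (\<lambda>j. run (sel j) (n j) ((a div k ^ j) # bs j)) [0..<m])"
    by (subst access_rec_product) (simp_all add: div_mult2_eq power_Suc2 del: power_Suc)
  also have "\<dots> \<bind> operations chi N sel as =
      product_list_pmf (map (\<lambda>j. run (sel j) (n j) (rev (map (\<lambda>a. a div k ^ j) as) @ (a div k ^ j) # bs j)) [0..<m])"
    by (rule Cons.IH)
  finally show ?case by simp
qed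

lemma init_orams_eq: "init_orams ns = product_list_pmf (map init_oram ns)"
  by (induction ns) simp_all

lemma rec_path_oram_product:
  assumes k: "k = labels_per_block chi N"
  shows "rec_path_oram chi m N sel as = product_list_pmf
    (map (\<lambda>j. run (sel j) (level_blocks k N j) (rev (map (\<lambda>a. a div k ^ j) as))) [0..<num_levels chi m N])"
  using operations_product[OF k, where n = "level_blocks k N" and bs = "\<lambda>_. []" and m = "num_levels chi m N"]
  by (simp add: rec_path_oram_def init_rec_def init_orams_eq k o_def)

text \<open>Rounding down the address and rounding up the size preserve the strict inequality. So
  the bound for a single ORAM applies on every level.\<close>

lemma div_power_less_level_blocks:
  assumes "k > 0" "a < N"
  shows "a div k ^ j < level_blocks k N j"
proof (induction j)
  case 0
  then show ?case using assms by simp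
next
  case (Suc j)
  define b where "b = a div k ^ j"
  have "real (b div k) \<le> real b / real k"
    by (rule of_nat_div_le_of_nat)
  also have "\<dots> < real (level_blocks k N j) / real k"
    using Suc assms(1) by (simp add: b_def divide_strict_right_mono)
  also have "\<dots> \<le> real (level_blocks k N (Suc j))"
    by (simp add: real_nat_ceiling_ge)
  finally show ?case
    by (simp only: of_nat_less_iff b_def div_mult2_eq power_Suc2)
qed

text \<open>Exponential Markov inequality: by independence the moment of the total size is a product
  of moments, each at most 6.\<close>

lemma common_failure_le:
  assumes N: "N \<ge> 2" and chi: "chi \<ge> 2" and sel: "\<And>j. valid_selection (sel j)" and as: "set as \<subseteq> {..<N}"
  shows "common_failure chi m N sel as R \<le> 6 ^ num_levels chi m N * (3 / 5) ^ R"
proof -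
  define k where "k = labels_per_block chi N"
  define p where "p = rec_path_oram chi m N sel as"
  define S :: "oram list \<Rightarrow> nat" where "S ss = (\<Sum>s\<leftarrow>ss. card (stash s))" for ss
  have k: "k > 0"
    using chi unfolding k_def labels_per_block_eq[OF N] by linarith
  have S: "ennreal ((5 / 3) ^ S ss) = prod_list (map (\<lambda>s. ennreal ((5 / 3) ^ card (stash s))) ss)" for ss
  proof (induction ss)
    case (Cons s ss)
    have "ennreal ((5 / 3) ^ S (s # ss)) = ennreal ((5 / 3) ^ card (stash s) * (5 / 3) ^ S ss)"
      by (simp add: S_def power_add)
    also have "\<dots> = ennreal ((5 / 3) ^ card (stash s)) * ennreal ((5 / 3) ^ S ss)"
      by (rule ennreal_mult) auto
    finally show ?case
      using Cons by simp
  qed (simp add: S_def)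
  define ps where "ps = map (\<lambda>j. run (sel j) (level_blocks k N j) (rev (map (\<lambda>a. a div k ^ j) as)))
    [0..<num_levels chi m N]"
  have p: "p = product_list_pmf ps"
    unfolding p_def ps_def by (rule rec_path_oram_product[OF k_def])
  have "(\<integral>\<^sup>+ss. ennreal ((5 / 3) ^ S ss) \<partial>p) \<le> 6 ^ length ps"
    unfolding S p
  proof (rule nn_integral_product_list_pmf_le)
    fix q assume "q \<in> set ps"
    then obtain j where q: "q = run (sel j) (level_blocks k N j) (rev (map (\<lambda>a. a div k ^ j) as))"
      by (auto simp: ps_def)
    have "a div k ^ j < level_blocks k N j" if "a \<in> set as" for a
      using that as by (intro div_power_less_level_blocks[OF k]) auto
    then show "(\<integral>\<^sup>+s. ennreal ((5 / 3) ^ card (stash s)) \<partial>q) \<le> 6"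
      unfolding q by (intro nn_integral_stash_run sel) auto
  qed
  then have "(\<integral>\<^sup>+ss. ennreal ((5 / 3) ^ S ss) \<partial>p) \<le> 6 ^ num_levels chi m N"
    by (simp add: ps_def)
  then have E: "(\<integral>\<^sup>+ss. ennreal ((3 / 5) ^ R) * ennreal ((5 / 3) ^ S ss) \<partial>p) \<le>
      ennreal ((3 / 5) ^ R) * 6 ^ num_levels chi m N"
    by (simp add: nn_integral_cmult mult_left_mono)
  have ind: "indicator {ss. S ss > R} ss \<le> ennreal ((3 / 5) ^ R) * ennreal ((5 / 3) ^ S ss)" for ss
  proof (cases "S ss > R")
    case True
    then have "(5 / 3 :: real) ^ R \<le> (5 / 3) ^ S ss"
      by (intro power_increasing) auto
    then have "(3 / 5 :: real) ^ R * (5 / 3) ^ R \<le> (3 / 5) ^ R * (5 / 3) ^ S ss"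
      by (intro mult_left_mono) auto
    then have "1 \<le> ennreal ((3 / 5) ^ R * (5 / 3) ^ S ss)"
      by (simp add: power_mult_distrib[symmetric])
    then show ?thesis
      using True by (simp add: ennreal_mult)
  qed simp
  have "emeasure p {ss. S ss > R} = (\<integral>\<^sup>+ss. indicator {ss. S ss > R} ss \<partial>p)"
    by simp
  also have "\<dots> \<le> (\<integral>\<^sup>+ss. ennreal ((3 / 5) ^ R) * ennreal ((5 / 3) ^ S ss) \<partial>p)"
    by (intro nn_integral_mono ind)
  also note E
  also have "ennreal ((3 / 5) ^ R) * 6 ^ num_levels chi m N = ennreal (6 ^ num_levels chi m N * (3 / 5) ^ R)"
    by (simp add: ennreal_mult mult.commute ennreal_power[symmetric])
  finally show ?thesis
    by (simp add: common_failure_def measure_pmf.emeasure_eq_measure p_def S_def)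
qed

lemma stash_failure_le:
  assumes i: "i < num_levels chi m N"
  shows "stash_failure chi m N sel as i R \<le> common_failure chi m N sel as R"
  unfolding stash_failure_def common_failure_def
proof (rule measure_pmf.finite_measure_mono_AE)
  show "AE ss in rec_path_oram chi m N sel as.
      ss \<in> {ss. card (stash (ss ! i)) > R} \<longrightarrow> ss \<in> {ss. (\<Sum>s\<leftarrow>ss. card (stash s)) > R}"
  proof (rule AE_pmfI)
    fix ss assume "ss \<in> set_pmf (rec_path_oram chi m N sel as)"
    then have "i < length ss"
      using i by (simp add: rec_path_oram_product[OF refl] length_product_list_pmf)
    then have "card (stash (ss ! i)) \<le> (\<Sum>s\<leftarrow>ss. card (stash s))"
      by (intro member_le_sum_list) auto
    then show "ss \<in> {ss. card (stash (ss ! i)) > R} \<longrightarrow> ss \<in> {ss. (\<Sum>s\<leftarrow>ss. card (stash s)) > R}"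
      by simp
  qed
qed auto


subsection \<open>Bandwidth\<close>

lemma access_rec_transferred:
  assumes "ss' \<in> set_pmf (access_rec k sel i a ss)"
  shows "map tree_height ss' = map tree_height ss \<and>
    total_transferred ss' = total_transferred ss + (\<Sum>h\<leftarrow>map tree_height ss. 2 * bucket_size * Suc h)"
  using assms
proof (induction ss arbitrary: i a ss')
  case Nil
  then show ?case by simp
next
  case (Cons s ss)
  then obtain ss'' s' where *: "ss'' \<in> set_pmf (access_rec k sel (Suc i) (a div k) ss)"
      "s' \<in> set_pmf (access (sel i) a s)" "ss' = s' # ss''"
    by auto
  show ?case
    using Cons.IH[OF *(1)] *(2,3) by (auto simp: access_eq total_transferred_def)
qed

lemma tree_heights_operations:
  assumes "ss' \<in> set_pmf (operations chi N sel as ss)"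
  shows "map tree_height ss' = map tree_height ss"
  using assms
  by (induction as arbitrary: ss) (auto simp: operation_def dest: access_rec_transferred)

lemma tree_heights_init_orams:
  "ss \<in> set_pmf (init_orams ns) \<Longrightarrow> map tree_height ss = map height_for ns"
  by (induction ns arbitrary: ss) (auto simp: init_oram_def)

text \<open>This is the exact cost of each operation, in every execution: on a level of height
  \<open>h\<close>, \<open>h + 1\<close> buckets are read and written.\<close>

definition operation_cost :: "real \<Rightarrow> nat \<Rightarrow> nat \<Rightarrow> real" where
  "operation_cost chi m N = (\<Sum>i<num_levels chi m N.
     2 * real bucket_size * Suc (height_for (level_blocks (labels_per_block chi N) N i)))"

lemma bandwidth_bound_operation_cost: "bandwidth_bound chi m N (operation_cost chi m N)"
  unfolding bandwidth_bound_def
proof (intro allI impI)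
  fix sel as a ss ss'
  assume ss: "ss \<in> set_pmf (rec_path_oram chi m N sel as)"
    and ss': "ss' \<in> set_pmf (operation chi N sel a ss)"
  have "map tree_height ss =
      map (\<lambda>i. height_for (level_blocks (labels_per_block chi N) N i)) [0..<num_levels chi m N]"
    using ss by (auto simp: rec_path_oram_def init_rec_def o_def
        dest!: tree_heights_operations tree_heights_init_orams)
  moreover have "total_transferred ss' =
      total_transferred ss + (\<Sum>h\<leftarrow>map tree_height ss. 2 * bucket_size * Suc h)"
    using access_rec_transferred ss' unfolding operation_def by blast
  ultimately have "total_transferred ss' = total_transferred ss + (\<Sum>i<num_levels chi m N.
      2 * bucket_size * Suc (height_for (level_blocks (labels_per_block chi N) N i)))"
    by (simp add: o_def interv_sum_list_conv_sum_set_nat atLeast0LessThan)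
  then show "real (total_transferred ss') - real (total_transferred ss) \<le> operation_cost chi m N"
    by (simp add: operation_cost_def algebra_simps)
qed


subsection \<open>Number of levels and asymptotics\<close>

text \<open>The repeated rounding up does not accumulate, because the bound \<open>k ^ t\<close> is
  itself an integer.\<close>

lemma level_blocks_le_power:
  assumes "k > 0"
  shows "N \<le> k ^ (i + t) \<Longrightarrow> level_blocks k N i \<le> k ^ t"
proof (induction i arbitrary: t)
  case 0
  then show ?case by simp
next
  case (Suc i)
  have "level_blocks k N i \<le> k ^ Suc t"
    using Suc.IH[of "Suc t"] Suc.prems by simp
  then have "real (level_blocks k N i) \<le> real (k ^ Suc t)"
    by (simp only: of_nat_le_iff)
  then have "real (level_blocks k N i) / real k \<le> real (k ^ t)"
    using assms by (simp add: field_simps)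
  then show ?case
    by (simp add: ceiling_le_iff nat_le_iff)
qed

lemma level_blocks_le:
  assumes "k > 0"
  shows "level_blocks k N i \<le> N"
proof (induction i)
  case (Suc i)
  have "real (level_blocks k N i) / real k \<le> real (level_blocks k N i)"
    using assms mult_left_mono[of 1 "real k" "real (level_blocks k N i)"] by (simp add: divide_le_eq)
  also have "\<dots> \<le> real N" using Suc by simp
  finally show ?case
    by (simp add: ceiling_le_iff nat_le_iff)
qed simp

text \<open>At most \<open>\<lceil>log k N\<rceil>\<close> divisions by \<open>k\<close> leave one
  block. The additive 2 comes from this rounding and from counting the data ORAM; the factor 2 comes
  from passing from \<open>k = \<lfloor>chi\<rfloor>\<close> to \<open>chi\<close>.\<close>

lemma num_levels_le:
  assumes N: "N \<ge> 2" and chi: "chi \<ge> 2" and m: "m \<ge> 1"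
  shows "real (num_levels chi m N) \<le> 2 + 2 * (log 2 N / log 2 chi)"
proof -
  define k where "k = labels_per_block chi N"
  have "int k = \<lfloor>chi\<rfloor>"
    using chi unfolding k_def labels_per_block_eq[OF N] by simp
  then have k: "k \<ge> 2" "chi < real k + 1"
    using chi by linarith+
  define i where "i = nat \<lceil>log k N\<rceil>"
  have lognn: "log k N \<ge> 0"
    using N k by simp
  have "real N = k powr log k N"
    using N k by simp
  also have "\<dots> \<le> k powr i"
    using k lognn by (intro powr_mono) (simp_all add: i_def real_nat_ceiling_ge)
  also have "\<dots> = real (k ^ i)"
    using k by (simp add: powr_realpow)
  finally have "N \<le> k ^ (i + 0)"
    by (simp only: of_nat_le_iff add_0_right)
  then have "level_blocks k N i \<le> k ^ 0"
    using k by (intro level_blocks_le_power) auto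
  then have "last_level chi m N \<le> i"
    unfolding last_level_def k_def[symmetric] using m by (intro Least_le) simp
  then have "real (num_levels chi m N) \<le> 1 + real i"
    by (simp add: num_levels_def)
  also have "real i \<le> log k N + 1"
    unfolding i_def using lognn by linarith
  also have "log k N = log 2 N / log 2 k"
    using N k by (simp add: log_def)
  also have "\<dots> \<le> 2 * (log 2 N / log 2 chi)"
  proof -
    \<comment> \<open>For \<open>k \<ge> 2\<close> this gives
      \<open>chi < k + 1 \<le> k * k\<close>, so rounding down at most halves the logarithm.\<close>
    have "real k + 1 \<le> real k * real k"
      using k mult_right_mono[of 2 "real k" "real k"] by linarith
    then have "log 2 chi \<le> log 2 (real k * real k)"
      using k chi by (intro log_mono) auto
    also have "\<dots> = 2 * log 2 k"
      using k by (simp add: log_mult)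
    finally have *: "log 2 chi / 2 \<le> log 2 k" by simp
    have "log 2 chi > 0" "log 2 N \<ge> 0"
      using chi N by auto
    then have "log 2 N / log 2 k \<le> log 2 N / (log 2 chi / 2)"
      using * by (intro divide_left_mono) auto
    then show ?thesis by (simp add: mult.commute)
  qed
  finally show ?thesis by simp
qed

lemma height_for_le:
  assumes "n \<le> N" "N \<ge> 1"
  shows "real (height_for n) \<le> log 2 N + 1"
proof (cases "n = 0")
  case True
  \<comment> \<open>By convention \<open>log 2 0\<close> is 0.\<close>
  then show ?thesis using assms by (simp add: height_for_def log_def)
next
  case False
  then have "log 2 n \<le> log 2 N" "0 \<le> log 2 n"
    using assms by auto
  then show ?thesis
    unfolding height_for_def by linarith
qed

lemma operation_cost_le:
  assumes N: "N \<ge> 2" and chi: "chi \<ge> 2"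
  shows "operation_cost chi m N \<le> 30 * (real (num_levels chi m N) * log 2 N)"
proof -
  have k: "labels_per_block chi N > 0"
    using chi unfolding labels_per_block_eq[OF N] by linarith
  have log: "log 2 N \<ge> 1" using N by simp
  have "2 * real bucket_size * Suc (height_for (level_blocks (labels_per_block chi N) N i)) \<le>
      30 * log 2 N" for i
  proof -
    define x where "x = real (height_for (level_blocks (labels_per_block chi N) N i))"
    define l where "l = log 2 (real N)"
    have "x \<le> l + 1"
      unfolding x_def l_def using height_for_le[OF level_blocks_le[OF k]] N by simp
    moreover have "l \<ge> 1"
      using log by (simp only: l_def)
    \<comment> \<open>The 10 is twice \<open>bucket_size\<close>, and
      \<open>1 + x \<le> l + 2 \<le> 3 * l\<close>.\<close>
    ultimately have "10 * (1 + x) \<le> 30 * l"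
      by simp
    then show ?thesis
      by (simp add: bucket_size_def x_def l_def)
  qed
  then have "operation_cost chi m N \<le> (\<Sum>i<num_levels chi m N. 30 * log 2 N)"
    unfolding operation_cost_def by (intro sum_mono)
  then show ?thesis by simp
qed

text \<open>The polynomial bound on \<open>chi\<close> keeps \<open>log N / log chi\<close> away
  from 0, so that it absorbs the additive constant.\<close>

lemma num_levels_bigo:
  assumes chi: "\<And>N. chi N \<ge> 2" and m: "\<And>N. m N \<ge> 1" and poly: "polynomially_bounded chi"
  shows "(\<lambda>N. real (num_levels (chi N) (m N) N)) \<in> O(\<lambda>N. log 2 (real N) / log 2 (chi N))"
proof -
  have pos: "log 2 (chi N) > 0" for N
    using chi[of N] by simp
  obtain C where "C > 0" and ev: "\<forall>\<^sub>F N in at_top. norm (log 2 (chi N)) \<le> C * norm (log 2 (real N))"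
    using poly unfolding polynomially_bounded_def by (elim landau_o.bigE)
  show ?thesis
  proof (rule landau_o.bigI[of "2 * C + 2"])
    show "\<forall>\<^sub>F N in at_top. norm (real (num_levels (chi N) (m N) N)) \<le>
        (2 * C + 2) * norm (log 2 (real N) / log 2 (chi N))"
      using ev eventually_ge_at_top[of 2]
    proof eventually_elim
      case (elim N)
      have "log 2 (real N) \<ge> 0" using elim(2) by simp
      then have "1 \<le> C * (log 2 (real N) / log 2 (chi N))"
        using elim(1) pos[of N] by (simp add: field_simps)
      then have "real (num_levels (chi N) (m N) N) \<le> (2 * C + 2) * (log 2 (real N) / log 2 (chi N))"
        using num_levels_le[OF elim(2) chi[of N] m[of N]] unfolding distrib_right by linarith
      then show ?case
        using pos[of N] \<open>log 2 (real N) \<ge> 0\<close> by (simp add: abs_of_nonneg)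
    qed
  qed (use \<open>C > 0\<close> in simp)
qed

lemma operation_cost_bigo:
  assumes chi: "\<And>N. chi N \<ge> 2" and m: "\<And>N. m N \<ge> 1" and poly: "polynomially_bounded chi"
  shows "(\<lambda>N. operation_cost (chi N) (m N) N) \<in> O(\<lambda>N. (log 2 (real N))\<^sup>2 / log 2 (chi N))"
proof -
  have "(\<lambda>N. operation_cost (chi N) (m N) N) \<in> O(\<lambda>N. real (num_levels (chi N) (m N) N) * log 2 (real N))"
  proof (rule landau_o.bigI[of 30])
    show "\<forall>\<^sub>F N in at_top. norm (operation_cost (chi N) (m N) N) \<le>
        30 * norm (real (num_levels (chi N) (m N) N) * log 2 (real N))"
      using eventually_ge_at_top[of 2]
    proof eventually_elim
      case (elim N)
      have "operation_cost (chi N) (m N) N \<ge> 0"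
        unfolding operation_cost_def by (intro sum_nonneg) simp
      then show ?case
        using operation_cost_le[OF elim chi[of N], of "m N"] by simp
    qed
  qed simp
  also have "(\<lambda>N. real (num_levels (chi N) (m N) N) * log 2 (real N)) \<in>
      O(\<lambda>N. log 2 (real N) / log 2 (chi N) * log 2 (real N))"
    by (intro landau_o.big.mult_right num_levels_bigo assms)
  also have "(\<lambda>N. log 2 (real N) / log 2 (chi N) * log 2 (real N)) = (\<lambda>N. (log 2 (real N))\<^sup>2 / log 2 (chi N))"
    by (simp add: power2_eq_square)
  finally show ?thesis .
qed

text \<open>With \<open>O(log N)\<close> levels the moments contribute a fixed power of
  \<open>N\<close>, while the tail contributes \<open>N\<close> to the power of minus a positive
  multiple of \<open>h N\<close>, which wins.\<close>

lemma superpoly_small_common_bound: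
  assumes chi: "\<And>N. chi N \<ge> 2" and m: "\<And>N. m N \<ge> 1"
    and h: "superconstant h" and R: "(\<lambda>N. real (R N)) \<in> \<Theta>(\<lambda>N. log 2 (real N) * h N)"
  shows "superpoly_small (\<lambda>N. {6 ^ num_levels (chi N) (m N) N * (3 / 5) ^ R N})"
proof -
  have "(\<lambda>N. real (R N)) \<in> \<Omega>(\<lambda>N. log 2 (real N) * h N)"
    using R by (rule bigthetaD2)
  then obtain d where d: "d > 0"
    and ev: "\<forall>\<^sub>F N in at_top. norm (real (R N)) \<ge> d * norm (log 2 (real N) * h N)"
    by (elim landau_omega.bigE)
  define c :: real where "c = log 2 (5 / 3)"
  \<comment> \<open>The 12 is \<open>3 * 4\<close>, from \<open>6 \<le> 2 ^ 3\<close> and at most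
    \<open>4 * log N\<close> levels.\<close>
  define e where "e N = - 12 + d * c * h N" for N
  have c: "c > 0" by (simp add: c_def)
  have h_top: "filterlim h at_top at_top"
    using h by (simp add: superconstant_def)
  have "superconstant e"
    unfolding superconstant_def e_def using c d
    by (intro filterlim_tendsto_add_at_top[OF tendsto_const] filterlim_tendsto_pos_mult_at_top[OF tendsto_const] h_top) simp
  moreover have "\<forall>\<^sub>F N in at_top. \<forall>p\<in>{6 ^ num_levels (chi N) (m N) N * (3 / 5) ^ R N}. p \<le> 1 / real N powr e N"
    \<comment> \<open>Eventually \<open>h N > 0\<close>, which removes the norm from the lower bound
      on \<open>R N\<close>.\<close>
    using ev eventually_ge_at_top[of 2] filterlim_at_top_dense[THEN iffD1, OF h_top, rule_format, of 0]
  proof eventually_elim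
    case (elim N)
    define l where "l = log 2 (real N)"
    have l: "l \<ge> 1" using elim(2) by (simp add: l_def)
    have N: "real N = 2 powr l" using elim(2) by (simp add: l_def)
    have "log 2 (chi N) \<ge> 1" using chi[of N] by simp
    then have "l / log 2 (chi N) \<le> l / 1"
      using l by (intro divide_left_mono) auto
    then have lev: "real (num_levels (chi N) (m N) N) \<le> 4 * l"
      using num_levels_le[OF elim(2) chi[of N] m[of N]] l by (simp add: l_def)
    have "(6::real) ^ num_levels (chi N) (m N) N \<le> 8 ^ num_levels (chi N) (m N) N"
      by (intro power_mono) auto
    also have "\<dots> = 2 powr (3 * real (num_levels (chi N) (m N) N))"
      by (simp add: powr_powr[symmetric] powr_realpow)
    also have "\<dots> \<le> 2 powr (12 * l)"
      using lev by (intro powr_mono) auto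
    finally have 1: "(6::real) ^ num_levels (chi N) (m N) N \<le> 2 powr (12 * l)" .
    have c': "(3 / 5 :: real) = 2 powr (- c)"
      by (simp add: c_def powr_minus)
    have "(3 / 5 :: real) ^ R N = 2 powr (- c * R N)"
      unfolding c' by (simp add: powr_power mult.commute)
    also have "d * (l * h N) \<le> real (R N)"
      using elim(1,3) l by (simp add: l_def)
    then have "2 powr (- c * R N) \<le> 2 powr (- c * (d * (l * h N)))"
      using c by (intro powr_mono) auto
    finally have 2: "(3 / 5 :: real) ^ R N \<le> 2 powr (- c * (d * (l * h N)))" .
    have "6 ^ num_levels (chi N) (m N) N * (3 / 5) ^ R N \<le> 2 powr (12 * l) * 2 powr (- c * (d * (l * h N)))"
      by (intro mult_mono 1 2) auto
    also have "\<dots> = 2 powr (- (l * e N))"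
      by (simp add: powr_add[symmetric] e_def algebra_simps)
    also have "\<dots> = 1 / real N powr e N"
      by (simp add: N powr_powr powr_minus_divide)
    finally show ?case by simp
  qed
  ultimately show ?thesis
    unfolding superpoly_small_def by blast
qed

lemma superpoly_small_mono:
  assumes "superpoly_small P" and "\<And>N p. N \<ge> 2 \<Longrightarrow> p \<in> P' N \<Longrightarrow> \<exists>q\<in>P N. p \<le> q"
  shows "superpoly_small P'"
proof -
  obtain e where e: "superconstant e" "\<forall>\<^sub>F N in at_top. \<forall>p\<in>P N. p \<le> 1 / real N powr e N"
    using assms(1) by (auto simp: superpoly_small_def)
  have "\<forall>\<^sub>F N in at_top. \<forall>p\<in>P' N. p \<le> 1 / real N powr e N"
    using e(2) eventually_ge_at_top[of 2] by eventually_elim (meson assms(2) order_trans)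
  with e(1) show ?thesis
    by (auto simp: superpoly_small_def)
qed

theorem mainTheorem3:
  fixes chi :: "nat \<Rightarrow> real" and m :: "nat \<Rightarrow> nat"
  assumes chi_ge_2: "\<And>N. chi N \<ge> 2"
    and client_map: "\<And>N. m N \<ge> 1"
  shows "(polynomially_bounded chi \<longrightarrow>
            (\<lambda>N. real (num_levels (chi N) (m N) N)) \<in> O(\<lambda>N. log 2 (real N) / log 2 (chi N)) \<and>
            (\<exists>B. B \<in> O(\<lambda>N. (log 2 (real N))\<^sup>2 / log 2 (chi N)) \<and>
                 (\<forall>N. bandwidth_bound (chi N) (m N) N (B N)))) \<and>
         (\<forall>(h :: nat \<Rightarrow> real) (R :: nat \<Rightarrow> nat).
            superconstant h \<longrightarrow> (\<lambda>N. real (R N)) \<in> \<Theta>(\<lambda>N. log 2 (real N) * h N) \<longrightarrow>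
              superpoly_small (\<lambda>N. {stash_failure (chi N) (m N) N sel as i (R N) | sel as i.
                 (\<forall>j. valid_selection (sel j)) \<and> set as \<subseteq> {..<N} \<and> i < num_levels (chi N) (m N) N}) \<and>
              (polynomially_bounded chi \<longrightarrow>
                (\<lambda>N. \<Sum>i<num_levels (chi N) (m N) N. real (R N))
                  \<in> O(\<lambda>N. (log 2 (real N))\<^sup>2 / log 2 (chi N) * h N))) \<and>
         (\<forall>(h :: nat \<Rightarrow> real) (R :: nat \<Rightarrow> nat).
            superconstant h \<longrightarrow> (\<lambda>N. real (R N)) \<in> \<Theta>(\<lambda>N. log 2 (real N) * h N) \<longrightarrow>
              superpoly_small (\<lambda>N. {common_failure (chi N) (m N) N sel as (R N) | sel as.
                 (\<forall>j. valid_selection (sel j)) \<and> set as \<subseteq> {..<N}}))"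
proof (intro conjI impI allI)
  assume poly: "polynomially_bounded chi"
  show "(\<lambda>N. real (num_levels (chi N) (m N) N)) \<in> O(\<lambda>N. log 2 (real N) / log 2 (chi N))"
    using assms poly by (rule num_levels_bigo)
  show "\<exists>B. B \<in> O(\<lambda>N. (log 2 (real N))\<^sup>2 / log 2 (chi N)) \<and>
      (\<forall>N. bandwidth_bound (chi N) (m N) N (B N))"
    by (intro exI[of _ "\<lambda>N. operation_cost (chi N) (m N) N"] conjI allI
        operation_cost_bigo assms poly bandwidth_bound_operation_cost)
next
  fix h :: "nat \<Rightarrow> real" and R :: "nat \<Rightarrow> nat"
  assume h: "superconstant h" and R: "(\<lambda>N. real (R N)) \<in> \<Theta>(\<lambda>N. log 2 (real N) * h N)"
  show "superpoly_small (\<lambda>N. {stash_failure (chi N) (m N) N sel as i (R N) | sel as i.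
      (\<forall>j. valid_selection (sel j)) \<and> set as \<subseteq> {..<N} \<and> i < num_levels (chi N) (m N) N})"
    \<comment> \<open>One bound dominates all failure probabilities, uniformly in selection rules,
      address sequence and level, so a single exponent serves.\<close>
    by (rule superpoly_small_mono[OF superpoly_small_common_bound[OF assms h R]])
      (use chi_ge_2 in \<open>auto intro!: order_trans[OF stash_failure_le common_failure_le]\<close>)
  assume "polynomially_bounded chi"
  then have "(\<lambda>N. real (num_levels (chi N) (m N) N) * real (R N)) \<in>
      O(\<lambda>N. log 2 (real N) / log 2 (chi N) * (log 2 (real N) * h N))"
    by (intro landau_o.big.mult num_levels_bigo assms bigthetaD1[OF R])
  then show "(\<lambda>N. \<Sum>i<num_levels (chi N) (m N) N. real (R N)) \<in>
      O(\<lambda>N. (log 2 (real N))\<^sup>2 / log 2 (chi N) * h N)"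
    by (simp add: power2_eq_square mult_ac)
next
  fix h :: "nat \<Rightarrow> real" and R :: "nat \<Rightarrow> nat"
  assume h: "superconstant h" and R: "(\<lambda>N. real (R N)) \<in> \<Theta>(\<lambda>N. log 2 (real N) * h N)"
  show "superpoly_small (\<lambda>N. {common_failure (chi N) (m N) N sel as (R N) | sel as.
      (\<forall>j. valid_selection (sel j)) \<and> set as \<subseteq> {..<N}})"
    by (rule superpoly_small_mono[OF superpoly_small_common_bound[OF assms h R]])
      (use chi_ge_2 in \<open>auto intro!: common_failure_le\<close>)
qed

end
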